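(* Let $S$ be the set of maximizers of $\int_{\mathbb{R}^2}|k*\omega|^2\,d\mathbf{x}$ over $\omega\in K$ (with $K$ as defined in the context). Choose any $\omega\in S$ and let $l:(0,\infty)\to[0,\infty)$ be the corresponding boundary function (as described in the context). Then $l$ is continuous in $(0,\infty)$ and the limit $\lim_{s\searrow0}l(s)$ exists and lies in $(0,\infty)$. Moreover, there exists $L\in(0,\infty)$ such that, for each $\epsilon\in(0,L)$, we have $l\in C^{1,r}([\epsilon,L])$ for each $r\in(0,1)$.
   Context: $\mathbb{R}^2_+:=\{(x_1,x_2)\in\mathbb{R}^2: x_2>0\}$. For $A\subset\mathbb{R}^2_+$, $A_-:=\{(x_1,x_2):(x_1,-x_2)\in A\}$. $k(\mathbf{x})=\frac{1}{2\pi}\frac{(-x_2,x_1)}{|\mathbf{x}|^2}$, and $\psi[\omega]:=-\big(\frac{1}{2\pi}\log|\cdot|\big)*\omega$. $K$ is the set of $\omega\in L^1(\mathbb{R}^2)$ such that $\omega=\mathbf{1}_A-\mathbf{1}_{A_-}$ a.e. in $\mathbb{R}^2$ for some open bounded set $A\subset\mathbb{R}^2_+$ satisfying $\int_A x_2\,d\mathbf{x}=1$. $S\subset K$ is the set of maximizers over $K$ of $\int_{\mathbb{R}^2}|k*\omega|^2d\mathbf{x}$. Corresponding function $l$: for each $\omega\in S$ there exist $\tau\in\mathbb{R}$, an open bounded set $\Omega\subset\mathbb{R}^2_+$ and a function $l:(0,\infty)\to[0,\infty)$ such that, with $\omega_\tau(x_1,x_2):=\omega(x_1-\tau,x_2)$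 and $W:=\frac13\int_{\mathbb{R}^2}|k*\omega|^2d\mathbf{x}>0$: $\omega_\tau=\mathbf{1}_\Omega-\mathbf{1}_{\Omega_-}$ a.e.; $\Omega=\{\mathbf{x}\in\mathbb{R}^2_+:\psi[\omega_\tau](\mathbf{x})-Wx_2>0\}$; and $\{(x_1,x_2)\in\Omega:x_2=s\}=\{(x_1,s):|x_1|<l(s)\}$ for each $s>0$. The function $l$ in the claim is this one. *)

theory Defs
  imports "HOL-Analysis.Analysis"
begin

definition half_plane :: "(real \<times> real) set" where
  "half_plane = {(x1, x2). x2 > 0}"

definition reflected :: "(real \<times> real) set \<Rightarrow> (real \<times> real) set" where
  "reflected A = {(x1, x2). (x1, - x2) \<in> A}"

text \<open>
  Elements of \<open>L\<^sup>1\<close> are represented by Lebesgue (not necessarily Borel) measurable functions, so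
  all integrals are taken with respect to \<^const>\<open>lebesgue\<close>; an integral against \<^const>\<open>lborel\<close>
  would be the junk value 0 for a non-Borel representative.  The kernel may be vector valued.
\<close>
definition conv :: "(real \<times> real \<Rightarrow> 'b::euclidean_space) \<Rightarrow> (real \<times> real \<Rightarrow> real) \<Rightarrow> real \<times> real \<Rightarrow> 'b"
  where "conv f w x = (LINT y|lebesgue. w y *\<^sub>R f (x - y))"

text \<open>The value at the origin (here 0, by the convention for division by zero) is irrelevant.\<close>
definition biot_savart :: "real \<times> real \<Rightarrow> real \<times> real" where
  "biot_savart x = (1 / (2 * pi * (norm x)\<^sup>2)) *\<^sub>R (- snd x, fst x)"

definition stream :: "(real \<times> real \<Rightarrow> real) \<Rightarrow> real \<times> real \<Rightarrow> real" where
  "stream w x = - conv (\<lambda>z. 1 / (2 * pi) * ln (norm z)) w x"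

text \<open>
  Valued in the extended nonnegative reals, so that a divergent integral counts as infinite
  (rather than as 0) in the maximization.
\<close>
definition energy :: "(real \<times> real \<Rightarrow> real) \<Rightarrow> ennreal" where
  "energy w = (\<integral>\<^sup>+x. ennreal ((norm (conv biot_savart w x))\<^sup>2) \<partial>lebesgue)"

definition odd_patch :: "(real \<times> real) set \<Rightarrow> real \<times> real \<Rightarrow> real" where
  "odd_patch A x = indicat_real A x - indicat_real (reflected A) x"

definition admissible :: "(real \<times> real \<Rightarrow> real) set" where
  "admissible = {w. integrable lebesgue w \<and>
     (\<exists>A. open A \<and> bounded A \<and> A \<subseteq> half_plane \<and> (LINT x:A|lebesgue. snd x) = 1 \<and>
          (AE x in lebesgue. w x = odd_patch A x))}"

definition maximizers :: "(real \<times> real \<Rightarrow> real) set" where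
  "maximizers = {w \<in> admissible. \<forall>v \<in> admissible. energy v \<le> energy w}"

definition shift_x1 :: "real \<Rightarrow> (real \<times> real \<Rightarrow> real) \<Rightarrow> real \<times> real \<Rightarrow> real" where
  "shift_x1 \<tau> w = (\<lambda>(x1, x2). w (x1 - \<tau>, x2))"

definition speed :: "(real \<times> real \<Rightarrow> real) \<Rightarrow> real" where
  "speed w = 1 / 3 * enn2real (energy w)"

text \<open>
  \<open>boundary_function w l\<close>: \<open>l\<close> is the boundary function corresponding to \<open>w\<close>.  Only the values
  \<open>l s\<close> for \<open>s > 0\<close> are meaningful, and the slice condition determines them.
\<close>
definition boundary_function :: "(real \<times> real \<Rightarrow> real) \<Rightarrow> (real \<Rightarrow> real) \<Rightarrow> bool" where
  "boundary_function w l \<longleftrightarrow>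
     speed w > 0 \<and> (\<forall>s>0. l s \<ge> 0) \<and>
     (\<exists>\<tau> \<Omega>. open \<Omega> \<and> bounded \<Omega> \<and> \<Omega> \<subseteq> half_plane \<and>
        (AE x in lebesgue. shift_x1 \<tau> w x = odd_patch \<Omega> x) \<and>
        \<Omega> = {x \<in> half_plane. stream (shift_x1 \<tau> w) x - speed w * snd x > 0} \<and>
        (\<forall>s>0. {x \<in> \<Omega>. snd x = s} = {(x1, s) | x1. \<bar>x1\<bar> < l s}))"

text \<open>The space \<open>C\<^sup>1\<^sup>,\<^sup>r([a,b])\<close>, with one-sided derivatives at the endpoints.\<close>
definition C1_holder :: "real \<Rightarrow> real \<Rightarrow> real \<Rightarrow> (real \<Rightarrow> real) \<Rightarrow> bool" where
  "C1_holder r a b f \<longleftrightarrow>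
     (\<exists>f'. (\<forall>x\<in>{a..b}. (f has_real_derivative f' x) (at x within {a..b})) \<and>
           continuous_on {a..b} f' \<and>
           (\<exists>C. \<forall>x\<in>{a..b}. \<forall>y\<in>{a..b}. \<bar>f' x - f' y\<bar> \<le> C * \<bar>x - y\<bar> powr r))"

end

(*
  Write F = psi - W x2, so that the patch is {F > 0} in the upper half-plane.  Interpolating the
  first and second order Taylor bounds for ln|z|, psi is differentiable with a gradient that is
  r-Hoelder for every r < 1.  Since the slices are centred intervals, reflecting in a vertical
  line y1 = m gives d1 psi < 0 for x1 > 0, and shows that the speed U(x1) = d2 psi (x1, 0) on the
  axis is even and strictly decreasing in |x1|.  Hence l is continuous, it inherits the regularity
  of grad psi wherever it is positive (implicit function theorem), and l(s) tends to the c with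
  U(c) = W, provided that U(0) > W.  To see this last inequality, integrate d2 F over the patch: F
  vanishes at both ends of every vertical segment, so W is the mean of d2 psi.  The contribution
  of the patch itself to that mean cancels by antisymmetry; the contribution of the mirror image,
  symmetrized in x and y, is (1/pi) times the mean over x of the integral over y of
  y2 / ((x1 - y1)^2 + (x2 + y2)^2), and dropping x2 from the denominator bounds it by the mean of
  U(x1), which is less than U(0).
*)
theory Submission imports Defs begin

section \<open>Axis-parallel isometries of the plane\<close>

text \<open>The gradient of psi need not be Lipschitz: second derivatives of the kernel have size
  |z|^(-2), which just fails to be integrable near 0 in the plane. The weight |z|^(-(1 + r)) is
  locally integrable exactly when r < 1, and this is the origin of the range of r. The axis is the
  delicate place. There psi vanishes, hence so does d1 psi, and implicit differentiation gives
  nothing at s = 0; this keeps the regularity on [eps, L]. The limit is read off from the normal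
  derivative instead: F(a, s) is (U(a) - W) s to first order, so the sign of U(a) - W decides
  whether (a, s) lies in the patch for small s. If U(0) were at most W, no c > 0 could satisfy U(c)
  = W. Vertical sections of the patch are merely open sets, possibly with infinitely many
  components. The integration of d2 F is therefore carried out with difference quotients and
  translations, and it yields that the mean of d2 psi is at least W, which is the direction
  used.\<close>

lemma lborel_distr_axis_isometry:
  fixes a b c d :: real
  assumes "\<bar>c\<bar> = 1" and "\<bar>d\<bar> = 1"
  shows "distr lborel borel (\<lambda>y. (a + c * fst y, b + d * snd y)) = (lborel :: (real \<times> real) measure)"
proof -
  have eq: "distr lborel borel (\<lambda>x::real. t + e * x) = lborel" if "\<bar>e\<bar> = 1" for t e :: real
    using lborel_real_affine[of e t] that by (auto simp: density_1)
  have "(lborel :: (real \<times> real) measure) =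
      distr lborel borel (\<lambda>x::real. a + c * x) \<Otimes>\<^sub>M distr lborel borel (\<lambda>x::real. b + d * x)"
    using assms by (simp add: eq lborel_prod)
  also have "\<dots> = distr (lborel \<Otimes>\<^sub>M lborel) (borel \<Otimes>\<^sub>M borel) (\<lambda>(x, y). (a + c * x, b + d * y))"
    using assms by (intro pair_measure_distr) (simp_all add: eq sigma_finite_lborel)
  also have "\<dots> = distr lborel borel (\<lambda>y. (a + c * fst y, b + d * snd y))"
    by (simp add: lborel_prod borel_prod case_prod_beta')
  finally show ?thesis ..
qed

text \<open>The signs \<open>c\<close> and \<open>d\<close> cover all changes of variables below:
  \<open>x - y\<close> in the kernels, the mirror image, reflection in a vertical line, and
  translation.\<close>

lemma
  fixes f :: "real \<times> real \<Rightarrow> 'b::{banach, second_countable_topology}" and a b c d :: real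
  assumes "\<bar>c\<bar> = 1" and "\<bar>d\<bar> = 1" and f [measurable]: "f \<in> borel_measurable borel"
  shows integral_axis_isometry:
      "(LINT y|lborel. f (a + c * fst y, b + d * snd y)) = (LINT y|lborel. f y)" (is ?int)
    and integrable_axis_isometry:
      "integrable lborel (\<lambda>y. f (a + c * fst y, b + d * snd y)) \<longleftrightarrow> integrable lborel f" (is ?iff)
proof -
  note eq = lborel_distr_axis_isometry[OF assms(1,2), of a b]
  have m: "(\<lambda>y. (a + c * fst y, b + d * snd y)) \<in> measurable lborel borel"
    by (auto intro!: borel_measurable_continuous_onI continuous_intros)
  show ?int
    by (subst (2) eq[symmetric], subst integral_distr[OF m f]) simp
  show ?iff
    by (subst (2) eq[symmetric], subst integrable_distr_eq[OF m f]) simp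
qed

lemma AE_axis_isometry:
  fixes a b c d :: real
  assumes "\<bar>c\<bar> = 1" and "\<bar>d\<bar> = 1" and "AE y::real\<times>real in lborel. P y"
  shows "AE y in lborel. P (a + c * fst y, b + d * snd y)"
proof -
  have m: "(\<lambda>y. (a + c * fst y, b + d * snd y)) \<in> measurable lborel lborel"
    by (auto intro!: borel_measurable_continuous_onI continuous_intros)
  have "distr lborel lborel (\<lambda>y. (a + c * fst y, b + d * snd y)) = (lborel :: (real \<times> real) measure)"
    using lborel_distr_axis_isometry[OF assms(1,2), of a b] by (simp cong: distr_cong)
  then show ?thesis
    using assms(3) AE_distrD[OF m, of P] by metis
qed

section \<open>Estimates for the logarithmic kernel\<close>

text \<open>\<open>inversion\<close> is the gradient of \<open>\<lambda>z. ln (norm z)\<close>.\<close>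
definition inversion :: "'a::real_inner \<Rightarrow> 'a" where
  "inversion z = z /\<^sub>R (norm z)\<^sup>2"

lemma norm_inversion: "norm (inversion z) = 1 / norm z"
  by (cases "z = 0") (simp_all add: inversion_def power2_eq_square divide_simps)

text \<open>The distance formula for inversion in the unit sphere. Being exact, it also applies when
  the segment from z to w meets 0, where a mean value argument would fail.\<close>

lemma norm_inversion_diff:
  assumes "z \<noteq> 0" "w \<noteq> 0"
  shows "norm (inversion z - inversion w) = norm (z - w) / (norm z * norm w)"
proof -
  define a b where "a = (norm z)\<^sup>2" and "b = (norm w)\<^sup>2"
  have ab: "a \<noteq> 0" "b \<noteq> 0" "z \<bullet> z = a" "w \<bullet> w = b"
    using assms by (simp_all add: a_def b_def dot_square_norm)
  have "(norm (inversion z - inversion w))\<^sup>2 = (z /\<^sub>R a - w /\<^sub>R b) \<bullet> (z /\<^sub>R a - w /\<^sub>R b)"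
    by (simp add: inversion_def a_def b_def dot_square_norm)
  also have "\<dots> = 1 / a - 2 * (z \<bullet> w) / (a * b) + 1 / b"
    using ab by (simp add: inner_diff_left inner_diff_right inner_commute[of w z] field_simps)
  also have "\<dots> = (a - 2 * (z \<bullet> w) + b) / (a * b)"
    using ab by (simp add: field_simps)
  also have "a - 2 * (z \<bullet> w) + b = (norm (z - w))\<^sup>2"
    using ab by (simp add: dot_square_norm[symmetric] inner_diff_left inner_diff_right inner_commute)
  finally have "(norm (inversion z - inversion w))\<^sup>2 = (norm (z - w) / (norm z * norm w))\<^sup>2"
    by (simp add: a_def b_def power_divide power_mult_distrib)
  then show ?thesis by (simp add: power2_eq_iff_nonneg)
qed

text \<open>Apply ln t \<le> t - 1 to t = |w|^2 / |z|^2 and expand |w|^2 about z, which is exact.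
  Again no segment has to avoid 0.\<close>

lemma ln_norm_diff_upper:
  assumes "z \<noteq> 0" "w \<noteq> 0"
  shows "ln (norm w) - ln (norm z) - inversion z \<bullet> (w - z) \<le> (norm (w - z))\<^sup>2 / (2 * (norm z)\<^sup>2)"
proof -
  have "2 * (ln (norm w) - ln (norm z)) = ln ((norm w)\<^sup>2 / (norm z)\<^sup>2)"
    using assms by (simp add: ln_div ln_realpow)
  also have "\<dots> \<le> (norm w)\<^sup>2 / (norm z)\<^sup>2 - 1"
    using assms by (intro ln_le_minus_one) simp
  also have "\<dots> = 2 * (inversion z \<bullet> (w - z)) + (norm (w - z))\<^sup>2 / (norm z)\<^sup>2"
    using assms
    by (simp add: dot_square_norm[symmetric] inversion_def inner_diff_left inner_diff_right
        inner_commute divide_simps)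
  finally show ?thesis by (simp add: field_simps)
qed

lemma abs_ln_norm_diff_le:
  assumes "z \<noteq> 0" "w \<noteq> 0"
  shows "\<bar>ln (norm w) - ln (norm z)\<bar> \<le> norm (w - z) * max (1 / norm z) (1 / norm w)"
proof -
  have "ln (norm w) - ln (norm z) \<le> norm (w - z) / norm z" if "z \<noteq> 0" "w \<noteq> 0" for z w :: 'a
  proof -
    have "ln (norm w) - ln (norm z) = ln (norm w / norm z)" using that by (simp add: ln_div)
    also have "\<dots> \<le> norm w / norm z - 1" using that by (intro ln_le_minus_one) simp
    also have "\<dots> = (norm w - norm z) / norm z" using that by (simp add: divide_simps)
    also have "\<dots> \<le> norm (w - z) / norm z" by (intro divide_right_mono norm_triangle_ineq2) simp
    finally show ?thesis .
  qed
  from this[OF assms] this[OF assms(2,1)]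
  have "\<bar>ln (norm w) - ln (norm z)\<bar> \<le> max (norm (w - z) * (1 / norm z)) (norm (w - z) * (1 / norm w))"
    by (auto simp: norm_minus_commute)
  then show ?thesis by (simp add: max_mult_distrib_left)
qed

text \<open>Turns a first order and a second order bound into one of any intermediate order
  p.\<close>

lemma min_linear_square_le_powr:
  fixes u p :: real
  assumes "u \<ge> 0" "1 \<le> p" "p \<le> 2"
  shows "min u (u\<^sup>2) \<le> u powr p"
proof (cases "u \<le> 1")
  case True
  then have "u powr 2 \<le> u powr p" using assms by (intro powr_mono') auto
  then show ?thesis using assms by (cases "u = 0") auto
next
  case False
  then have "u powr 1 \<le> u powr p" using assms by (intro powr_mono) auto
  then show ?thesis using assms False by auto
qed

lemma max_inverse_powr_le:
  fixes a b p :: real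
  assumes "a > 0" "b > 0"
  shows "max (1 / a) (1 / b) powr p \<le> a powr - p + b powr - p"
  using assms by (auto simp: max_def powr_minus powr_divide inverse_eq_divide)

text \<open>With h = |w - z| and m the larger of 1/|z| and 1/|w|, the remainder is at most 2 h m and
  also at most 2 (h m)^2; interpolate. The resulting weight |z|^(-p) + |w|^(-p) is locally
  integrable in the plane when p < 2.\<close>

lemma ln_norm_taylor:
  assumes "z \<noteq> 0" "w \<noteq> 0" and p: "1 \<le> p" "p \<le> 2"
  shows "\<bar>ln (norm w) - ln (norm z) - inversion z \<bullet> (w - z)\<bar>
    \<le> 2 * norm (w - z) powr p * (norm z powr - p + norm w powr - p)" (is "\<bar>?A\<bar> \<le> _")
proof -
  define h m where "h = norm (w - z)" and "m = max (1 / norm z) (1 / norm w)"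
  have h: "h \<ge> 0" and m: "m > 0" "1 / norm z \<le> m" "1 / norm w \<le> m"
    using assms by (auto simp: h_def m_def less_max_iff_disj)
  have zz: "1 / (norm z)\<^sup>2 \<le> m\<^sup>2" and ww: "1 / (norm w)\<^sup>2 \<le> m\<^sup>2"
    using m power_mono[of "1 / norm z" m 2] power_mono[of "1 / norm w" m 2]
    by (auto simp: power_one_over)
  have zw: "1 / (norm z * norm w) \<le> m\<^sup>2"
    using mult_mono[OF m(2,3)] m by (simp add: power2_eq_square)
  have up: "ln (norm w) - ln (norm z) - inversion z \<bullet> (w - z) \<le> h\<^sup>2 * m\<^sup>2 / 2"
    using ln_norm_diff_upper[OF assms(1,2)] mult_left_mono[OF zz, of "h\<^sup>2"] by (simp add: h_def)
  have "ln (norm z) - ln (norm w) - inversion w \<bullet> (z - w) \<le> h\<^sup>2 * m\<^sup>2 / 2"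
    using ln_norm_diff_upper[OF assms(2,1)] mult_left_mono[OF ww, of "h\<^sup>2"]
    by (simp add: h_def norm_minus_commute)
  \<comment> \<open>The lower bound on the remainder is the upper bound with z and w exchanged; this
    is the cost of moving the gradient back from w to z.\<close>
  moreover have "inversion z \<bullet> (w - z) - inversion w \<bullet> (w - z) \<le> h\<^sup>2 * m\<^sup>2"
  proof -
    have "inversion z \<bullet> (w - z) - inversion w \<bullet> (w - z) \<le> norm (inversion z - inversion w) * h"
      by (simp add: inner_diff_left[symmetric] norm_cauchy_schwarz h_def)
    also have "\<dots> = h\<^sup>2 * (1 / (norm z * norm w))"
      using assms by (simp add: norm_inversion_diff h_def norm_minus_commute power2_eq_square)
    also have "\<dots> \<le> h\<^sup>2 * m\<^sup>2" using zw by (intro mult_left_mono) auto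
    finally show ?thesis .
  qed
  moreover have "inversion w \<bullet> (z - w) = - (inversion w \<bullet> (w - z))"
    by (simp add: inner_diff_right)
  ultimately have sq: "\<bar>?A\<bar> \<le> 2 * (h * m)\<^sup>2"
    using up by (simp add: power_mult_distrib abs_le_iff)
  have "\<bar>inversion z \<bullet> (w - z)\<bar> \<le> norm (inversion z) * h"
    unfolding h_def by (rule Cauchy_Schwarz_ineq2)
  also have "\<dots> \<le> m * h" using m h by (intro mult_right_mono) (auto simp: norm_inversion)
  finally have "\<bar>?A\<bar> \<le> 2 * (h * m)"
    using abs_ln_norm_diff_le[OF assms(1,2)] by (simp add: h_def m_def mult.commute)
  with sq have "\<bar>?A\<bar> \<le> 2 * min (h * m) ((h * m)\<^sup>2)" by simp
  also have "\<dots> \<le> 2 * (h * m) powr p"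
    using h m p by (intro mult_left_mono min_linear_square_le_powr) auto
  also have "\<dots> = 2 * h powr p * m powr p" using h m by (simp add: powr_mult)
  also have "\<dots> \<le> 2 * h powr p * (norm z powr - p + norm w powr - p)"
    unfolding m_def using assms by (intro mult_left_mono max_inverse_powr_le) auto
  finally show ?thesis by (simp add: h_def)
qed

text \<open>Same interpolation, after multiplying by h so that the two bounds become multiples of h
  m and (h m)^2. For p = 1 + r the weight agrees with that of \<open>ln_norm_taylor\<close>.\<close>

lemma inversion_holder:
  assumes "z \<noteq> 0" "w \<noteq> 0" and p: "1 \<le> p" "p \<le> 2"
  shows "norm (inversion w - inversion z)
    \<le> 2 * norm (w - z) powr (p - 1) * (norm z powr - p + norm w powr - p)"
proof (cases "w = z")
  case True
  then show ?thesis by simp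
next
  case False
  define h m where "h = norm (w - z)" and "m = max (1 / norm z) (1 / norm w)"
  have h: "h > 0" and m: "m > 0" "1 / norm z \<le> m" "1 / norm w \<le> m"
    using assms False by (auto simp: h_def m_def less_max_iff_disj)
  have zw: "1 / (norm z * norm w) \<le> m\<^sup>2"
    using mult_mono[OF m(2,3)] m by (simp add: power2_eq_square)
  have "h * norm (inversion w - inversion z) = h\<^sup>2 * (1 / (norm z * norm w))"
    using assms by (simp add: norm_inversion_diff h_def power2_eq_square)
  also have "\<dots> \<le> h\<^sup>2 * m\<^sup>2" using zw by (intro mult_left_mono) auto
  finally have 1: "h * norm (inversion w - inversion z) \<le> (h * m)\<^sup>2"
    by (simp add: power_mult_distrib)
  have "norm (inversion w - inversion z) \<le> 1 / norm w + 1 / norm z"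
    using norm_triangle_ineq4[of "inversion w" "inversion z"] by (simp add: norm_inversion)
  also have "\<dots> \<le> 2 * m" using m by simp
  finally have "h * norm (inversion w - inversion z) \<le> 2 * (h * m)" using h by simp
  with 1 have "h * norm (inversion w - inversion z) \<le> 2 * min (h * m) ((h * m)\<^sup>2)"
    using zero_le_power2[of "h * m"] by linarith
  also have "\<dots> \<le> 2 * (h * m) powr p"
    using h m p by (intro mult_left_mono min_linear_square_le_powr) auto
  also have "\<dots> = 2 * h powr p * m powr p" using h m by (simp add: powr_mult)
  also have "\<dots> \<le> 2 * h powr p * (norm z powr - p + norm w powr - p)"
    unfolding m_def using assms by (intro mult_left_mono max_inverse_powr_le) auto
  also have "h powr p = h * h powr (p - 1)" using h by (simp add: powr_diff)
  finally show ?thesis using h by (simp add: h_def)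
qed

section \<open>The logarithmic potential of a bounded density\<close>

lemma integrable_abs_powr:
  fixes q :: real
  assumes "q < 1"
  shows "integrable lborel (\<lambda>t. indicat_real {-1..1} t * \<bar>t\<bar> powr - q)"
proof -
  have "(\<lambda>t. t powr - q) absolutely_integrable_on {0..1}"
    using has_integral_powr_from_0[of "- q" 1] assms
    by (intro nonnegative_absolutely_integrable_1) (auto simp: integrable_on_def)
  then have pos: "integrable lborel (\<lambda>t. indicat_real {0..1} t * t powr - q)"
    by (simp add: set_integrable_def integrable_completion)
  then have "integrable lborel (\<lambda>t. indicat_real {0..1} (0 + (- 1) * t) * (0 + (- 1) * t) powr - q)"
    by (rule lborel_integrable_real_affine) simp
  with pos have "integrable lborel (\<lambda>t. indicat_real {0..1} t * t powr - q +
      indicat_real {0..1} (0 + (- 1) * t) * (0 + (- 1) * t) powr - q)"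
    by (rule Bochner_Integration.integrable_add)
  moreover have "(\<lambda>t. indicat_real {0..1} t * t powr - q +
      indicat_real {0..1} (0 + (- 1) * t) * (0 + (- 1) * t) powr - q) =
      (\<lambda>t. indicat_real {-1..1} t * \<bar>t\<bar> powr - q)"
    by (rule ext) (auto simp: indicator_def)
  ultimately show ?thesis by simp
qed

lemma integrable_lborel_prod_mult:
  fixes f g :: "real \<Rightarrow> real"
  assumes "integrable lborel f" "integrable lborel g"
  shows "integrable lborel (\<lambda>z. f (fst z) * g (snd z))"
proof -
  have [measurable]: "f \<in> borel_measurable borel" "g \<in> borel_measurable borel"
    using assms by auto
  have "integrable (lborel \<Otimes>\<^sub>M lborel) (\<lambda>z. f (fst z) * g (snd z))"
    using assms by (intro lborel_pair.Fubini_integrable) (auto simp: abs_mult)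
  then show ?thesis by (simp add: lborel_prod)
qed

lemma AE_fst_neq: "AE y :: real \<times> real in lborel. fst y \<noteq> a"
  and AE_snd_neq: "AE y :: real \<times> real in lborel. snd y \<noteq> b"
proof -
  have 1: "{y. y \<bullet> i = c} \<in> null_sets lborel" if "i \<in> Basis" for c and i :: "real \<times> real"
    using negligible_standard_hyperplane[OF that, of c]
    by (subst null_sets_completion_iff[symmetric])
       (auto simp: negligible_iff_null_sets intro!: borel_closed closed_hyperplane
          simp: inner_commute[of _ i])
  have a: "{y :: real \<times> real. fst y = a} \<in> null_sets lborel"
    and b: "{y :: real \<times> real. snd y = b} \<in> null_sets lborel"
    using 1[of "(1, 0)" a] 1[of "(0, 1)" b] by (simp_all add: Basis_prod_def inner_prod_def)
  show "AE y :: real \<times> real in lborel. fst y \<noteq> a"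
    by (rule AE_I'[OF a]) auto
  show "AE y :: real \<times> real in lborel. snd y \<noteq> b"
    by (rule AE_I'[OF b]) auto
qed

lemma AE_neq: "AE y in lborel. y \<noteq> (x :: real \<times> real)"
  using AE_fst_neq[of "fst x"] by eventually_elim auto

text \<open>A substitute for polar coordinates: |z| dominates both coordinates, so the singularity
  splits into two one-dimensional ones of order p/2, integrable when p < 2. The coordinates must be
  nonzero since \<open>0 powr - q\<close> is 0, so the product would vanish there.\<close>

lemma norm_powr_le_prod:
  fixes z :: "real \<times> real"
  assumes "fst z \<noteq> 0" "snd z \<noteq> 0" "p \<ge> 0"
  shows "norm z powr - p \<le> 1 + (indicat_real {-1..1} (fst z) * \<bar>fst z\<bar> powr - (p / 2)) *
    (indicat_real {-1..1} (snd z) * \<bar>snd z\<bar> powr - (p / 2))"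
proof (cases "\<bar>fst z\<bar> \<le> 1 \<and> \<bar>snd z\<bar> \<le> 1")
  case True
  have le: "\<bar>fst z\<bar> \<le> norm z" "\<bar>snd z\<bar> \<le> norm z"
    using norm_fst_le[of "fst z" "snd z"] norm_snd_le[of "snd z" "fst z"] by auto
  have "norm z powr - p = norm z powr - (p / 2) * norm z powr - (p / 2)"
    by (simp add: powr_add[symmetric])
  also have "\<dots> \<le> \<bar>fst z\<bar> powr - (p / 2) * \<bar>snd z\<bar> powr - (p / 2)"
    using assms le by (intro mult_mono powr_mono2') auto
  finally show ?thesis using True by (auto simp: indicator_def abs_le_iff)
next
  case False
  then have "1 \<le> norm z"
    using norm_fst_le[of "fst z" "snd z"] norm_snd_le[of "snd z" "fst z"] by auto
  then have "norm z powr - p \<le> norm z powr 0" using assms by (intro powr_mono) auto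
  also have "\<dots> = 1" using \<open>1 \<le> norm z\<close> by auto
  finally show ?thesis by (rule order_trans) simp
qed

text \<open>Uniformity in x comes from translation invariance: the integral of the dominating
  \<open>k (x - y)\<close> over the whole plane does not depend on x.\<close>

lemma riesz_kernel_bounded:
  fixes B :: "(real \<times> real) set"
  assumes p: "0 \<le> p" "p < 2" and B [measurable]: "B \<in> sets borel" and "bounded B"
  obtains M where "M \<ge> 0"
    and "\<And>x. integrable lborel (\<lambda>y. indicat_real B y * norm (x - y) powr - p)"
    and "\<And>x. (LINT y|lborel. indicat_real B y * norm (x - y) powr - p) \<le> M"
proof -
  define g where "g t = indicat_real {-1..1} t * \<bar>t\<bar> powr - (p / 2)" for t :: real
  define k where "k z = g (fst z) * g (snd z)" for z :: "real \<times> real"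
  have g: "integrable lborel g"
    unfolding g_def using p by (intro integrable_abs_powr) simp
  then have k: "integrable lborel k"
    unfolding k_def by (intro integrable_lborel_prod_mult)
  then have [measurable]: "k \<in> borel_measurable borel" by auto
  have k': "integrable lborel (\<lambda>y. k (x - y))"
    and kint: "(LINT y|lborel. k (x - y)) = (LINT z|lborel. k z)" for x
    using k integrable_axis_isometry[of "-1" "-1" k "fst x" "snd x"]
      integral_axis_isometry[of "-1" "-1" k "fst x" "snd x"]
    by (simp_all add: minus_prod_def)
  have iB: "integrable lborel (indicat_real B)"
    using emeasure_bounded_finite[OF \<open>bounded B\<close>] by simp
  have le: "AE y in lborel. indicat_real B y * norm (x - y) powr - p \<le> indicat_real B y + k (x - y)" for x
    using AE_fst_neq[of "fst x"] AE_snd_neq[of "snd x"]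
  proof eventually_elim
    case (elim y)
    then have "norm (x - y) powr - p \<le> 1 + k (x - y)"
      unfolding k_def g_def using p by (intro norm_powr_le_prod) auto
    moreover have "k (x - y) \<ge> 0" by (simp add: k_def g_def)
    ultimately show ?case by (auto simp: indicator_def)
  qed
  have int: "integrable lborel (\<lambda>y. indicat_real B y * norm (x - y) powr - p)" for x
  proof (rule Bochner_Integration.integrable_bound)
    show "integrable lborel (\<lambda>y. indicat_real B y + k (x - y))"
      using iB k' by (rule Bochner_Integration.integrable_add)
    show "AE y in lborel. norm (indicat_real B y * norm (x - y) powr - p) \<le> norm (indicat_real B y + k (x - y))"
      using le[of x] by eventually_elim (auto intro: order_trans)
  qed measurable
  have "(LINT y|lborel. indicat_real B y * norm (x - y) powr - p) \<le> measure lborel B + (LINT z|lborel. k z)" for x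
  proof -
    have "(LINT y|lborel. indicat_real B y * norm (x - y) powr - p) \<le> (LINT y|lborel. indicat_real B y + k (x - y))"
      using int iB k' le by (intro integral_mono_AE Bochner_Integration.integrable_add)
    also have "\<dots> = measure lborel B + (LINT z|lborel. k z)"
      using iB k' by (simp add: kint)
    finally show ?thesis .
  qed
  moreover have "0 \<le> measure lborel B + (LINT z|lborel. k z)"
    by (intro add_nonneg_nonneg Bochner_Integration.integral_nonneg) (auto simp: k_def g_def)
  ultimately show thesis using int that by blast
qed

lemma powr_minus_one_real: "u powr - 1 = 1 / u" if "u \<ge> 0" for u :: real
  using that by (cases "u = 0") (simp_all add: powr_minus_divide)

text \<open>\<open>abs_le\<close> says in one inequality that the density is bounded by 1 and
  vanishes off \<open>B\<close>.\<close>

locale bounded_density =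
  fixes \<omega> :: "real \<times> real \<Rightarrow> real" and B :: "(real \<times> real) set"
  assumes meas [measurable]: "\<omega> \<in> borel_measurable borel"
    and supp_meas [measurable]: "B \<in> sets borel"
    and bounded_supp: "bounded B"
    and abs_le: "\<bar>\<omega> y\<bar> \<le> indicat_real B y"
begin

definition log_pot :: "real \<times> real \<Rightarrow> real" where
  "log_pot x = (LINT y|lborel. \<omega> y * ln (norm (x - y)))"

text \<open>The gradient of \<open>log_pot\<close> as suggested by differentiating under the
  integral sign; \<open>log_pot_taylor\<close> confirms it.\<close>

definition log_grad :: "real \<times> real \<Rightarrow> real \<times> real" where
  "log_grad x = (LINT y|lborel. \<omega> y *\<^sub>R inversion (x - y))"

lemma inversion_measurable [measurable]:
  "(\<lambda>y::real\<times>real. inversion (x - y)) \<in> borel_measurable borel"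
  unfolding inversion_def by measurable

lemma integrable_indicator: "integrable lborel (indicat_real B)"
  using emeasure_bounded_finite[OF bounded_supp] by simp

lemma riesz_integrable:
  assumes "0 \<le> p" "p < 2"
  shows "integrable lborel (\<lambda>y. indicat_real B y * norm (x - y) powr - p)"
  by (rule riesz_kernel_bounded[OF assms supp_meas bounded_supp]) blast

lemma riesz_bounded:
  assumes "0 \<le> p" "p < 2"
  obtains M where "M \<ge> 0"
    and "\<And>x. (LINT y|lborel. indicat_real B y * norm (x - y) powr - p) \<le> M"
  by (rule riesz_kernel_bounded[OF assms supp_meas bounded_supp]) (rule that)

lemma integrable_log_grad: "integrable lborel (\<lambda>y. \<omega> y *\<^sub>R inversion (x - y))"
proof (rule Bochner_Integration.integrable_bound)
  show "integrable lborel (\<lambda>y. indicat_real B y * norm (x - y) powr - 1)"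
    by (rule riesz_integrable) simp_all
qed (auto simp: norm_inversion powr_minus_one_real intro!: divide_right_mono abs_le)

lemma log_grad_bounded: obtains M where "\<And>x. norm (log_grad x) \<le> M"
proof -
  have *: "integrable lborel (\<lambda>y. indicat_real B y / norm (x - y))" for x
    using riesz_integrable[of 1 x] by (simp add: powr_minus_one_real)
  obtain M where M: "\<And>x. (LINT y|lborel. indicat_real B y * norm (x - y) powr - 1) \<le> M"
    by (rule riesz_bounded[of 1]; (rule that)?) simp_all
  have "norm (log_grad x) \<le> (LINT y|lborel. indicat_real B y / norm (x - y))" for x
    unfolding log_grad_def
  proof (rule order_trans[OF integral_norm_bound], rule integral_mono)
    show "integrable lborel (\<lambda>y. norm (\<omega> y *\<^sub>R inversion (x - y)))"
      by (intro integrable_norm integrable_log_grad)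
    show "norm (\<omega> y *\<^sub>R inversion (x - y)) \<le> indicat_real B y / norm (x - y)" for y
      using divide_right_mono[OF abs_le[of y], of "norm (x - y)"] by (simp add: norm_inversion)
  qed (rule *)
  from order_trans[OF this] M have "norm (log_grad x) \<le> M" for x
    by (simp add: powr_minus_one_real)
  then show thesis by (rule that)
qed

lemma integrable_log_pot: "integrable lborel (\<lambda>y. \<omega> y * ln (norm (x - y)))"
proof -
  have *: "integrable lborel (\<lambda>y. indicat_real B y * norm (x - y) powr - 1)"
    by (rule riesz_integrable) simp_all
  obtain R where R: "\<And>y. y \<in> B \<Longrightarrow> norm y \<le> R" using bounded_supp by (auto simp: bounded_iff)
  \<comment> \<open>On a bounded set this crude bound reduces the logarithm to a constant plus the
    kernel with p = 1.\<close>
  have ln: "\<bar>ln u\<bar> \<le> u + u powr - 1" if "u > 0" for u :: real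
  proof -
    have "ln u \<le> u - 1" "- ln u \<le> 1 / u - 1" "0 < 1 / u"
      using ln_le_minus_one[of u] ln_le_minus_one[of "1 / u"] that by (simp_all add: ln_div)
    then have "\<bar>ln u\<bar> \<le> u + 1 / u" using that by linarith
    then show ?thesis using that by (simp add: powr_minus_one_real)
  qed
  show ?thesis
  proof (rule Bochner_Integration.integrable_bound)
    show "integrable lborel (\<lambda>y. (norm x + R) * indicat_real B y + indicat_real B y * norm (x - y) powr - 1)"
      using integrable_indicator * by (intro Bochner_Integration.integrable_add) auto
    show "AE y in lborel. norm (\<omega> y * ln (norm (x - y))) \<le>
        norm ((norm x + R) * indicat_real B y + indicat_real B y * norm (x - y) powr - 1)"
      using AE_neq[of x]
    proof eventually_elim
      case (elim y)
      show ?case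
      proof (cases "y \<in> B")
        case True
        have "\<bar>\<omega> y\<bar> * \<bar>ln (norm (x - y))\<bar> \<le> 1 * (norm (x - y) + norm (x - y) powr - 1)"
          using abs_le[of y] True elim by (intro mult_mono ln) auto
        also have "\<dots> \<le> (norm x + R) + norm (x - y) powr - 1"
          using norm_triangle_ineq4[of x y] R[OF True] by simp
        finally show ?thesis using True by (simp add: abs_mult)
      next
        case False
        then show ?thesis using abs_le[of y] by simp
      qed
    qed
  qed measurable
qed

text \<open>Integrate \<open>inversion_holder\<close> with p = 1 + r < 2. The constant 4 M is the
  factor 2 of that estimate times the two weights, each of integral at most M.\<close>

lemma log_grad_holder:
  assumes r: "0 < r" "r < 1"
  obtains C where "C \<ge> 0" "\<And>x x'. norm (log_grad x' - log_grad x) \<le> C * norm (x' - x) powr r"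
proof -
  have int: "integrable lborel (\<lambda>y. indicat_real B y * norm (x - y) powr - (1 + r))" for x
    using r by (intro riesz_integrable) simp_all
  obtain M where M: "M \<ge> 0"
    "\<And>x. (LINT y|lborel. indicat_real B y * norm (x - y) powr - (1 + r)) \<le> M"
    by (rule riesz_bounded[of "1 + r"]) (use r in simp_all)
  have "norm (log_grad x' - log_grad x) \<le> 4 * M * norm (x' - x) powr r" for x x'
  proof -
    have "log_grad x' - log_grad x = (LINT y|lborel. \<omega> y *\<^sub>R (inversion (x' - y) - inversion (x - y)))"
      unfolding log_grad_def
      by (simp add: scaleR_diff_right Bochner_Integration.integral_diff integrable_log_grad)
    also have "norm \<dots> \<le> (LINT y|lborel. 2 * norm (x' - x) powr r *
        (indicat_real B y * norm (x - y) powr - (1 + r) + indicat_real B y * norm (x' - y) powr - (1 + r)))"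
    proof (rule order_trans[OF integral_norm_bound], rule integral_mono_AE)
      show "integrable lborel (\<lambda>y. norm (\<omega> y *\<^sub>R (inversion (x' - y) - inversion (x - y))))"
        by (intro integrable_norm) (simp add: scaleR_diff_right integrable_log_grad)
      show "AE y in lborel. norm (\<omega> y *\<^sub>R (inversion (x' - y) - inversion (x - y))) \<le>
        2 * norm (x' - x) powr r *
        (indicat_real B y * norm (x - y) powr - (1 + r) + indicat_real B y * norm (x' - y) powr - (1 + r))"
        using AE_neq[of x] AE_neq[of x']
      proof eventually_elim
        case (elim y)
        have "\<bar>\<omega> y\<bar> * norm (inversion (x' - y) - inversion (x - y)) \<le>
          indicat_real B y * (2 * norm (x' - x) powr r *
             (norm (x - y) powr - (1 + r) + norm (x' - y) powr - (1 + r)))"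
          using inversion_holder[of "x - y" "x' - y" "1 + r"] r elim abs_le[of y]
          by (intro mult_mono) auto
        then show ?case by (simp add: distrib_left mult_ac)
      qed
    qed (use int in auto)
    also have "\<dots> \<le> 2 * norm (x' - x) powr r * (M + M)"
      using mult_left_mono[OF add_mono[OF M(2)[of x] M(2)[of x']], of "2 * norm (x' - x) powr r"] int
      by simp
    finally show ?thesis by (simp add: algebra_simps)
  qed
  then show thesis using that[of "4 * M"] M by auto
qed

text \<open>Integrating the pointwise Taylor estimate of the kernel avoids differentiation under the
  integral sign; since the order 1 + r exceeds 1, it gives differentiability of the potential
  everywhere.\<close>

lemma log_pot_taylor:
  assumes r: "0 < r" "r < 1"
  obtains C where "C \<ge> 0"
    "\<And>x x'. \<bar>log_pot x' - log_pot x - log_grad x \<bullet> (x' - x)\<bar> \<le> C * norm (x' - x) powr (1 + r)"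
proof -
  have int: "integrable lborel (\<lambda>y. indicat_real B y * norm (x - y) powr - (1 + r))" for x
    using r by (intro riesz_integrable) simp_all
  obtain M where M: "M \<ge> 0"
    "\<And>x. (LINT y|lborel. indicat_real B y * norm (x - y) powr - (1 + r)) \<le> M"
    by (rule riesz_bounded[of "1 + r"]) (use r in simp_all)
  have "\<bar>log_pot x' - log_pot x - log_grad x \<bullet> (x' - x)\<bar> \<le> 4 * M * norm (x' - x) powr (1 + r)" for x x'
  proof -
    let ?f = "\<lambda>y. \<omega> y * (ln (norm (x' - y)) - ln (norm (x - y)) - inversion (x - y) \<bullet> (x' - x))"
    have f: "?f = (\<lambda>y. \<omega> y * ln (norm (x' - y)) - \<omega> y * ln (norm (x - y)) - (\<omega> y *\<^sub>R inversion (x - y)) \<bullet> (x' - x))"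
      by (auto simp: algebra_simps)
    have "log_pot x' - log_pot x - log_grad x \<bullet> (x' - x) = (LINT y|lborel. ?f y)"
      unfolding f log_grad_def log_pot_def
      by (simp add: integrable_log_pot integrable_log_grad del: inner_scaleR_left)
    also have "\<bar>\<dots>\<bar> \<le> (LINT y|lborel. 2 * norm (x' - x) powr (1 + r) *
        (indicat_real B y * norm (x - y) powr - (1 + r) + indicat_real B y * norm (x' - y) powr - (1 + r)))"
    proof (rule order_trans[OF integral_abs_bound], rule integral_mono_AE)
      show "integrable lborel (\<lambda>y. \<bar>?f y\<bar>)"
        by (intro integrable_abs, subst f, intro Bochner_Integration.integrable_diff integrable_log_pot
            integrable_inner_left integrable_log_grad)
      show "AE y in lborel. \<bar>?f y\<bar> \<le> 2 * norm (x' - x) powr (1 + r) *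
        (indicat_real B y * norm (x - y) powr - (1 + r) + indicat_real B y * norm (x' - y) powr - (1 + r))"
        using AE_neq[of x] AE_neq[of x']
      proof eventually_elim
        case (elim y)
        have "\<bar>?f y\<bar> \<le> indicat_real B y * (2 * norm (x' - x) powr (1 + r) *
             (norm (x - y) powr - (1 + r) + norm (x' - y) powr - (1 + r)))"
          using ln_norm_taylor[of "x - y" "x' - y" "1 + r"] r elim abs_le[of y]
          unfolding abs_mult by (intro mult_mono) auto
        then show ?case by (simp add: algebra_simps)
      qed
    qed (use int in auto)
    also have "\<dots> \<le> 2 * norm (x' - x) powr (1 + r) * (M + M)"
      using mult_left_mono[OF add_mono[OF M(2)[of x] M(2)[of x']], of "2 * norm (x' - x) powr (1 + r)"] int
      by simp
    finally show ?thesis by (simp add: algebra_simps)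
  qed
  then show thesis using that[of "4 * M"] M by auto
qed

end

section \<open>Patches with centred slices\<close>

lemma
  fixes f :: "'a \<Rightarrow> real \<times> real"
  assumes f [measurable]: "f \<in> borel_measurable M"
  shows borel_measurable_fst_plane [measurable (raw)]: "(\<lambda>x. fst (f x)) \<in> borel_measurable M"
    and borel_measurable_snd_plane [measurable (raw)]: "(\<lambda>x. snd (f x)) \<in> borel_measurable M"
  by (auto intro!: measurable_compose[OF f] borel_measurable_continuous_onI continuous_intros)

definition mirror :: "real \<times> real \<Rightarrow> real \<times> real" where
  "mirror x = (fst x, - snd x)"

lemma mirror_simps [simp]:
  "fst (mirror x) = fst x" "snd (mirror x) = - snd x" "mirror (mirror x) = x"
  "mirror (x - y) = mirror x - mirror y"
  "norm (mirror x) = norm x" "mirror x \<bullet> y = x \<bullet> mirror y"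
  by (auto simp: mirror_def norm_prod_def inner_prod_def minus_prod_def)

lemma norm_divideR: "c > 0 \<Longrightarrow> norm (v /\<^sub>R c) = norm v / c"
  for v :: "'a::real_normed_vector"
  by (simp add: field_simps)

lemma continuous_on_mirror [continuous_intros]: "continuous_on S f \<Longrightarrow> continuous_on S (\<lambda>x. mirror (f x))"
  unfolding mirror_def by (intro continuous_intros)

lemma mirror_measurable [measurable]: "mirror \<in> borel_measurable borel"
  by (intro borel_measurable_continuous_onI continuous_intros)

lemma
  fixes z :: "real \<times> real"
  shows fst_inversion: "fst (inversion z) = fst z / ((fst z)\<^sup>2 + (snd z)\<^sup>2)"
    and snd_inversion: "snd (inversion z) = snd z / ((fst z)\<^sup>2 + (snd z)\<^sup>2)"
  by (auto simp: inversion_def norm_prod_def divide_inverse)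

lemma reflected_iff: "x \<in> reflected A \<longleftrightarrow> mirror x \<in> A"
  by (cases x) (auto simp: reflected_def mirror_def)

text \<open>Isolates the geometry: \<open>slice\<close> makes the patch Steiner symmetric about the
  line x1 = 0. The level set condition and W enter only later.\<close>

locale steiner_patch =
  fixes \<Omega> :: "(real \<times> real) set" and l :: "real \<Rightarrow> real"
  assumes open_patch: "open \<Omega>" and bounded_patch: "bounded \<Omega>"
    and upper: "\<Omega> \<subseteq> half_plane" and nonempty: "\<Omega> \<noteq> {}"
    and slice: "s > 0 \<Longrightarrow> (a, s) \<in> \<Omega> \<longleftrightarrow> \<bar>a\<bar> < l s"
begin

lemma patch_measurable [measurable]: "\<Omega> \<in> sets borel"
  using open_patch by simp

sublocale bounded_density "indicat_real \<Omega>" \<Omega>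
  using bounded_patch by unfold_locales auto

lemma in_patch_iff: "y \<in> \<Omega> \<longleftrightarrow> snd y > 0 \<and> \<bar>fst y\<bar> < l (snd y)"
  using slice[of "snd y" "fst y"] upper by (cases y) (auto simp: half_plane_def)

lemma fst_symmetric: "(- a, s) \<in> \<Omega> \<longleftrightarrow> (a, s) \<in> \<Omega>"
  by (simp add: in_patch_iff)

text \<open>Reflecting the part of \<open>\<Omega>\<close> right of \<open>y\<^sub>1 = m\<close> lands in \<open>\<Omega>\<close>, so that
  part is cancelled and only points left of the line contribute.\<close>

lemma reflection_integral_pos:
  assumes "m > 0" and [measurable]: "h \<in> borel_measurable borel"
    and int: "integrable lborel (\<lambda>y. indicat_real \<Omega> y * h y)"
    and odd: "\<And>y1 y2. h (2 * m - y1, y2) = - h (y1, y2)"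
    and pos: "\<And>y1 y2. y1 < m \<Longrightarrow> y2 > 0 \<Longrightarrow> h (y1, y2) > 0"
  shows "(LINT y|lborel. indicat_real \<Omega> y * h y) > 0"
proof (rule ccontr)
  define R where "R y = (2 * m - fst y, snd y)" for y :: "real \<times> real"
  \<comment> \<open>Adding the reflected integrand doubles the integral and makes the integrand
    nonnegative pointwise.\<close>
  define f where "f y = (indicat_real \<Omega> y - indicat_real \<Omega> (R y)) * h y" for y
  let ?I = "LINT y|lborel. indicat_real \<Omega> y * h y"
  have R: "R y = (2 * m + (- 1) * fst y, 0 + 1 * snd y)" for y by (simp add: R_def)
  have [measurable]: "R \<in> borel_measurable borel"
    unfolding R_def by (intro borel_measurable_continuous_onI continuous_intros)
  have hR: "h (R y) = - h y" for y using odd[of "fst y" "snd y"] by (simp add: R_def)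
  have intR: "integrable lborel (\<lambda>y. indicat_real \<Omega> (R y) * h (R y))"
    and eqR: "(LINT y|lborel. indicat_real \<Omega> (R y) * h (R y)) = ?I"
    using int integrable_axis_isometry[of "-1" 1 "\<lambda>y. indicat_real \<Omega> y * h y" "2 * m" 0]
      integral_axis_isometry[of "-1" 1 "\<lambda>y. indicat_real \<Omega> y * h y" "2 * m" 0]
    unfolding R by simp_all
  have f_eq: "f = (\<lambda>y. indicat_real \<Omega> y * h y + indicat_real \<Omega> (R y) * h (R y))"
    by (auto simp: f_def hR algebra_simps)
  have f_int: "integrable lborel f" and f_integral: "integral\<^sup>L lborel f = 2 * ?I"
    unfolding f_eq using int intR eqR by simp_all
  have f_nonneg: "f y \<ge> 0" for y
  proof -
    consider "fst y < m" | "fst y = m" | "fst y > m" by linarith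
    then show ?thesis
    proof cases
      case 1
      have "R y \<in> \<Omega> \<Longrightarrow> y \<in> \<Omega>" using 1 \<open>m > 0\<close> by (auto simp: in_patch_iff R_def)
      moreover have "y \<in> \<Omega> \<Longrightarrow> h y > 0"
        using pos[OF 1, of "snd y"] by (auto simp: in_patch_iff)
      ultimately show ?thesis by (auto simp: f_def indicator_def)
    next
      case 2
      then have "R y = y" by (simp add: R_def prod_eq_iff)
      then show ?thesis by (simp add: f_def)
    next
      case 3
      have "y \<in> \<Omega> \<Longrightarrow> R y \<in> \<Omega>" using 3 \<open>m > 0\<close> by (auto simp: in_patch_iff R_def)
      moreover have "R y \<in> \<Omega> \<Longrightarrow> h y < 0"
        using pos[of "fst (R y)" "snd (R y)"] 3 hR[of y] by (auto simp: in_patch_iff R_def)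
      ultimately show ?thesis by (auto simp: f_def indicator_def)
    qed
  qed
  assume "\<not> ?I > 0"
  moreover have "integral\<^sup>L lborel f \<ge> 0" using f_nonneg by simp
  ultimately have "integral\<^sup>L lborel f = 0" using f_integral by simp
  then have ae: "AE y in lborel. f y = 0"
    using integral_nonneg_eq_0_iff_AE[OF f_int] f_nonneg by simp
  define S where "S = Sup (fst ` \<Omega>)"
  have bdd: "bdd_above (fst ` \<Omega>)"
    using bounded_patch by (intro bounded_imp_bdd_above bounded_fst)
  have S: "fst y \<le> S" if "y \<in> \<Omega>" for y
    unfolding S_def using bdd that by (intro cSup_upper) auto
  obtain q where "q \<in> \<Omega>" using nonempty by blast
  then have "S \<ge> 0" using S[of q] S[of "(- fst q, snd q)"] fst_symmetric[of "fst q" "snd q"] by auto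
  obtain p where p: "p \<in> \<Omega>" "fst p > S - m"
    using less_cSupD[of "fst ` \<Omega>" "S - m"] nonempty \<open>m > 0\<close> by (auto simp: S_def)
  \<comment> \<open>Strictness: \<open>D\<close> lies left of the line y1 = m, and its reflection
    falls beyond the supremum S of all abscissas, so nothing cancels there. It contains (- fst p,
    snd p) for a point p of the patch with abscissa above S - m.\<close>
  define D where "D = \<Omega> \<inter> {y. fst y < min m (2 * m - S)}"
  have "open D"
    unfolding D_def using open_patch by (intro open_Int open_Collect_less continuous_intros) auto
  moreover have "(- fst p, snd p) \<in> D"
    using p \<open>S \<ge> 0\<close> \<open>m > 0\<close> fst_symmetric[of "fst p" "snd p"] by (simp add: D_def)
  ultimately have "\<not> negligible D" using open_not_negligible by blast
  moreover have "D \<in> null_sets lborel"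
  proof -
    have "f y > 0" if "y \<in> D" for y
    proof -
      have "R y \<notin> \<Omega>" using that S[of "R y"] by (auto simp: D_def R_def)
      moreover have "h y > 0" using that pos[of "fst y" "snd y"] by (auto simp: D_def in_patch_iff)
      ultimately show ?thesis using that by (simp add: f_def D_def)
    qed
    then have "f y = 0 \<longrightarrow> y \<notin> D" for y by (metis less_irrefl)
    with ae have "AE y in lborel. y \<notin> D" by (simp add: eventually_mono)
    then show ?thesis using \<open>open D\<close> by (subst (asm) AE_iff_null_sets[symmetric]) auto
  qed
  ultimately show False by (simp add: negligible_iff_null_sets null_sets_completionI)
qed

section \<open>Stream function of the odd patch\<close>

definition \<psi> :: "real \<times> real \<Rightarrow> real" where
  "\<psi> x = (log_pot (mirror x) - log_pot x) / (2 * pi)"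

definition d\<psi> :: "real \<times> real \<Rightarrow> real \<times> real" where
  "d\<psi> x = (mirror (log_grad (mirror x)) - log_grad x) /\<^sub>R (2 * pi)"

text \<open>Method of images: the potential of the reflected patch at x is that of the patch at
  \<open>mirror x\<close>, so all estimates for one density carry over to
  \<open>\<psi>\<close>.\<close>

lemma stream_odd_patch: "stream (odd_patch \<Omega>) = \<psi>"
proof
  fix x
  have [measurable]: "odd_patch \<Omega> \<in> borel_measurable borel"
    unfolding odd_patch_def indicator_def reflected_iff by measurable
  have mir: "mirror y = (0 + 1 * fst y, 0 + (- 1) * snd y)" for y by (simp add: mirror_def)
  let ?g = "\<lambda>y. indicat_real \<Omega> y * ln (norm (mirror x - y))"
  have int: "integrable lborel (\<lambda>y. ?g (mirror y))"
    and eq: "(LINT y|lborel. ?g (mirror y)) = log_pot (mirror x)"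
    using integrable_log_pot[of "mirror x"] integrable_axis_isometry[of 1 "-1" ?g 0 0]
      integral_axis_isometry[of 1 "-1" ?g 0 0]
    unfolding mir log_pot_def by simp_all
  have "stream (odd_patch \<Omega>) x = - (LINT y|lborel. odd_patch \<Omega> y * (1 / (2 * pi) * ln (norm (x - y))))"
    by (simp add: stream_def conv_def integral_completion)
  also have "(\<lambda>y. odd_patch \<Omega> y * (1 / (2 * pi) * ln (norm (x - y)))) =
      (\<lambda>y. (indicat_real \<Omega> y * ln (norm (x - y)) - ?g (mirror y)) / (2 * pi))"
  proof
    fix y
    have "indicat_real (reflected \<Omega>) y = indicat_real \<Omega> (mirror y)"
      by (simp add: indicator_def reflected_iff)
    moreover have "norm (mirror x - mirror y) = norm (x - y)"
      by (metis mirror_simps(4,5))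
    ultimately show "odd_patch \<Omega> y * (1 / (2 * pi) * ln (norm (x - y))) =
        (indicat_real \<Omega> y * ln (norm (x - y)) - ?g (mirror y)) / (2 * pi)"
      by (simp only: odd_patch_def) (simp only: left_diff_distrib times_divide_eq_left times_divide_eq_right mult_1)
  qed
  also have "- (LINT y|lborel. (indicat_real \<Omega> y * ln (norm (x - y)) - ?g (mirror y)) / (2 * pi)) = \<psi> x"
    using integrable_log_pot[of x] int eq
    by (simp add: \<psi>_def log_pot_def[of x] diff_divide_distrib)
  finally show "stream (odd_patch \<Omega>) x = \<psi> x" .
qed

lemma \<psi>_taylor:
  assumes r: "0 < r" "r < 1"
  obtains C where "C \<ge> 0"
    "\<And>x x'. \<bar>\<psi> x' - \<psi> x - d\<psi> x \<bullet> (x' - x)\<bar> \<le> C * norm (x' - x) powr (1 + r)"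
proof -
  obtain C where C: "C \<ge> 0"
    "\<And>x x'. \<bar>log_pot x' - log_pot x - log_grad x \<bullet> (x' - x)\<bar> \<le> C * norm (x' - x) powr (1 + r)"
    using log_pot_taylor[OF r] by metis
  have "\<bar>\<psi> x' - \<psi> x - d\<psi> x \<bullet> (x' - x)\<bar> \<le> C / pi * norm (x' - x) powr (1 + r)" for x x'
  proof -
    let ?E = "\<lambda>x x'. log_pot x' - log_pot x - log_grad x \<bullet> (x' - x)"
    have "mirror x' - mirror x = mirror (x' - x)" by simp
    then have n: "norm (mirror x' - mirror x) = norm (x' - x)" by (metis mirror_simps(5))
    have "\<psi> x' - \<psi> x - d\<psi> x \<bullet> (x' - x) = (?E (mirror x) (mirror x') - ?E x x') / (2 * pi)"
    proof -
      have "d\<psi> x \<bullet> (x' - x) =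
          (log_grad (mirror x) \<bullet> (mirror x' - mirror x) - log_grad x \<bullet> (x' - x)) / (2 * pi)"
        by (simp add: d\<psi>_def inner_diff_left field_simps)
      then show ?thesis unfolding \<psi>_def diff_divide_distrib by linarith
    qed
    also have "\<bar>\<dots>\<bar> \<le> (C * norm (x' - x) powr (1 + r) + C * norm (x' - x) powr (1 + r)) / (2 * pi)"
    proof -
      have "\<bar>?E (mirror x) (mirror x') - ?E x x'\<bar> \<le>
          C * norm (x' - x) powr (1 + r) + C * norm (x' - x) powr (1 + r)"
        using C(2)[of "mirror x'" "mirror x"] C(2)[of x' x] unfolding n by linarith
      then show ?thesis unfolding abs_divide by (intro divide_mono) auto
    qed
    finally show ?thesis by (simp add: field_simps)
  qed
  then show thesis using that[of "C / pi"] C(1) by simp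
qed

lemma d\<psi>_holder:
  assumes r: "0 < r" "r < 1"
  obtains C where "C \<ge> 0" "\<And>x x'. norm (d\<psi> x' - d\<psi> x) \<le> C * norm (x' - x) powr r"
proof -
  obtain C where C: "C \<ge> 0"
    "\<And>x x'. norm (log_grad x' - log_grad x) \<le> C * norm (x' - x) powr r"
    using log_grad_holder[OF r] by metis
  have "norm (d\<psi> x' - d\<psi> x) \<le> C / pi * norm (x' - x) powr r" for x x'
  proof -
    let ?E = "\<lambda>x x'. log_grad x' - log_grad x"
    have n: "norm (mirror x' - mirror x) = norm (x' - x)" by (metis mirror_simps(4,5))
    have "d\<psi> x' - d\<psi> x = (mirror (?E (mirror x) (mirror x')) - ?E x x') /\<^sub>R (2 * pi)"
      by (simp add: d\<psi>_def algebra_simps)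
    also have "norm \<dots> = norm (mirror (?E (mirror x) (mirror x')) - ?E x x') / (2 * pi)"
      by (rule norm_divideR) simp
    also have "\<dots> \<le> (norm (mirror (?E (mirror x) (mirror x'))) + norm (?E x x')) / (2 * pi)"
      by (intro divide_right_mono norm_triangle_ineq4) auto
    also have "\<dots> \<le> (C * norm (x' - x) powr r + C * norm (x' - x) powr r) / (2 * pi)"
      using C(2)[of "mirror x'" "mirror x"] C(2)[of x' x] unfolding n mirror_simps(5)
      by (intro divide_right_mono add_mono) auto
    finally show ?thesis by (simp add: field_simps)
  qed
  then show thesis using that[of "C / pi"] C(1) by simp
qed

lemma has_derivative_\<psi>: "(\<psi> has_derivative (\<lambda>h. d\<psi> x \<bullet> h)) (at x)"
proof -
  \<comment> \<open>Any exponent in (0, 1) would do.\<close>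
  have half: "0 < (1 / 2 :: real)" "1 / 2 < (1 :: real)" by simp_all
  obtain C where C: "C \<ge> 0"
    "\<And>x x'. \<bar>\<psi> x' - \<psi> x - d\<psi> x \<bullet> (x' - x)\<bar> \<le> C * norm (x' - x) powr (1 + 1 / 2)"
    by (rule \<psi>_taylor[OF half], rule that)
  show ?thesis
  proof (rule has_derivativeI_sandwich[of 1])
    show "bounded_linear ((\<bullet>) (d\<psi> x))" by (rule bounded_linear_inner_right)
    have "((\<lambda>x'. C * norm (x' - x) powr (1 / 2)) \<longlongrightarrow> C * norm (x - x) powr (1 / 2)) (at x)"
      by (intro tendsto_intros) auto
    then show "((\<lambda>x'. C * norm (x' - x) powr (1 / 2)) \<longlongrightarrow> 0) (at x)" by simp
    show "norm (\<psi> x' - \<psi> x - d\<psi> x \<bullet> (x' - x)) / norm (x' - x) \<le> C * norm (x' - x) powr (1 / 2)"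
      if "x' \<noteq> x" for x'
    proof -
      have "norm (x' - x) powr (1 + 1 / 2) = norm (x' - x) * norm (x' - x) powr (1 / 2)"
        by (simp only: powr_add) simp
      with C(2)[of x' x] have "\<bar>\<psi> x' - \<psi> x - d\<psi> x \<bullet> (x' - x)\<bar> \<le>
          C * norm (x' - x) powr (1 / 2) * norm (x' - x)"
        by (simp only: mult_ac)
      then show ?thesis using that by (simp add: pos_divide_le_eq)
    qed
  qed simp
qed

lemma continuous_on_\<psi>: "continuous_on S \<psi>"
  by (intro continuous_at_imp_continuous_on ballI has_derivative_continuous[OF has_derivative_\<psi>])

lemma continuous_on_d\<psi>: "continuous_on S d\<psi>"
proof -
  have half: "0 < (1 / 2 :: real)" "1 / 2 < (1 :: real)" by simp_all
  obtain C where C: "C \<ge> 0" "\<And>x x'. norm (d\<psi> x' - d\<psi> x) \<le> C * norm (x' - x) powr (1 / 2)"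
    by (rule d\<psi>_holder[OF half], rule that)
  have "(d\<psi> \<longlongrightarrow> d\<psi> x) (at x)" for x
  proof (rule Lim_null[THEN iffD2], rule Lim_null_comparison)
    show "\<forall>\<^sub>F x' in at x. norm (d\<psi> x' - d\<psi> x) \<le> C * norm (x' - x) powr (1 / 2)"
      using C by simp
    have "((\<lambda>x'. C * norm (x' - x) powr (1 / 2)) \<longlongrightarrow> C * norm (x - x) powr (1 / 2)) (at x)"
      by (intro tendsto_intros) auto
    then show "((\<lambda>x'. C * norm (x' - x) powr (1 / 2)) \<longlongrightarrow> 0) (at x)" by simp
  qed
  then show ?thesis by (auto intro!: continuous_at_imp_continuous_on simp: isCont_def)
qed

lemma d\<psi>_bounded: obtains M where "\<And>x. norm (d\<psi> x) \<le> M"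
proof -
  obtain M where M: "\<And>x. norm (log_grad x) \<le> M" by (rule log_grad_bounded, rule that)
  have "norm (d\<psi> x) \<le> (M + M) / (2 * pi)" for x
  proof -
    have "norm (d\<psi> x) = norm (mirror (log_grad (mirror x)) - log_grad x) / (2 * pi)"
      unfolding d\<psi>_def by (rule norm_divideR) simp
    also have "\<dots> \<le> (norm (mirror (log_grad (mirror x))) + norm (log_grad x)) / (2 * pi)"
      by (intro divide_right_mono norm_triangle_ineq4) auto
    also have "\<dots> \<le> (M + M) / (2 * pi)"
      using M by (intro divide_right_mono add_mono) auto
    finally show ?thesis .
  qed
  then show thesis by (rule that)
qed

lemma \<psi>_axis: "\<psi> (a, 0) = 0"
  by (simp add: \<psi>_def mirror_def)

lemma integrable_fst_inversion: "integrable lborel (\<lambda>y. indicat_real \<Omega> y * fst (inversion (x - y)))"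
  and integrable_snd_inversion: "integrable lborel (\<lambda>y. indicat_real \<Omega> y * snd (inversion (x - y)))"
  using integrable_fst[OF integrable_log_grad[of x]] integrable_snd[OF integrable_log_grad[of x]]
  by simp_all

lemma fst_log_grad: "fst (log_grad x) = (LINT y|lborel. indicat_real \<Omega> y * fst (inversion (x - y)))"
  and snd_log_grad: "snd (log_grad x) = (LINT y|lborel. indicat_real \<Omega> y * snd (inversion (x - y)))"
  unfolding log_grad_def
  by (simp_all flip: integral_fst[OF integrable_log_grad] integral_snd[OF integrable_log_grad])

text \<open>Apply the reflection argument in the line y1 = a. The kernel is odd about it because its
  numerator is a - y1, and positive on its left because a point y of the upper half-plane is closer
  to (a, s) than to (a, - s).\<close>

lemma fst_d\<psi>_neg:
  assumes "a > 0" "s > 0"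
  shows "fst (d\<psi> (a, s)) < 0"
proof -
  let ?h = "\<lambda>y. fst (inversion ((a, s) - y)) - fst (inversion ((a, - s) - y))"
  have "(LINT y|lborel. indicat_real \<Omega> y * ?h y) > 0"
  proof (rule reflection_integral_pos[OF \<open>a > 0\<close>])
    show "integrable lborel (\<lambda>y. indicat_real \<Omega> y * ?h y)"
      by (simp only: right_diff_distrib integrable_fst_inversion Bochner_Integration.integrable_diff)
    show "?h (2 * a - y1, y2) = - ?h (y1, y2)" for y1 y2
    proof -
      have "- t / ((- t)\<^sup>2 + u) - - t / ((- t)\<^sup>2 + v) = - (t / (t\<^sup>2 + u) - t / (t\<^sup>2 + v))"
        for t u v :: real by simp
      moreover have "a - (2 * a - y1) = - (a - y1)" by simp
      ultimately show ?thesis by (simp only: fst_inversion fst_diff snd_diff fst_conv snd_conv)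
    qed
    show "?h (y1, y2) > 0" if "y1 < a" "y2 > 0" for y1 y2
    proof -
      have "(s - y2)\<^sup>2 < (- s - y2)\<^sup>2"
        using that \<open>s > 0\<close> by (simp add: power2_eq_square algebra_simps)
      then have "(a - y1) / ((a - y1)\<^sup>2 + (- s - y2)\<^sup>2) < (a - y1) / ((a - y1)\<^sup>2 + (s - y2)\<^sup>2)"
        using that by (intro divide_strict_left_mono mult_pos_pos add_pos_nonneg) auto
      then show ?thesis by (simp add: fst_inversion)
    qed
  qed measurable
  then have "fst (log_grad (a, s)) - fst (log_grad (a, - s)) > 0"
    by (simp add: fst_log_grad right_diff_distrib integrable_fst_inversion)
  then show ?thesis by (simp add: d\<psi>_def mirror_def mult_less_0_iff field_simps)
qed

section \<open>Velocity on the axis\<close>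

definition axis_speed :: "real \<Rightarrow> real" where
  "axis_speed a = snd (d\<psi> (a, 0))"

lemma integrable_poisson: "integrable lborel (\<lambda>y. indicat_real \<Omega> y * (snd y / ((a - fst y)\<^sup>2 + (snd y)\<^sup>2)))"
  using integrable_snd_inversion[of "(a, 0)"] by (simp add: snd_inversion)

text \<open>This is the Poisson integral for the half-plane; patch and image contribute equally on
  the axis, which turns 1/(2 pi) into 1/pi.\<close>

lemma axis_speed_eq:
  "axis_speed a = (LINT y|lborel. indicat_real \<Omega> y * (snd y / ((a - fst y)\<^sup>2 + (snd y)\<^sup>2))) / pi"
  by (simp add: axis_speed_def d\<psi>_def mirror_def snd_log_grad snd_inversion field_simps)

text \<open>Reflection in the midline y1 = (a + b)/2 exchanges the Poisson kernels at a and b, so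
  their difference is odd about it; left of it the kernel at a is larger.\<close>

lemma axis_speed_strict_decreasing:
  assumes "0 \<le> a" "a < b"
  shows "axis_speed b < axis_speed a"
proof -
  let ?p = "\<lambda>t y. snd y / ((t - fst y)\<^sup>2 + (snd y)\<^sup>2)"
  have "(LINT y|lborel. indicat_real \<Omega> y * (?p a y - ?p b y)) > 0"
  proof (rule reflection_integral_pos[of "(a + b) / 2"])
    show "integrable lborel (\<lambda>y. indicat_real \<Omega> y * (?p a y - ?p b y))"
      by (simp only: right_diff_distrib integrable_poisson Bochner_Integration.integrable_diff)
    show "?p a (2 * ((a + b) / 2) - y1, y2) - ?p b (2 * ((a + b) / 2) - y1, y2) =
        - (?p a (y1, y2) - ?p b (y1, y2))" for y1 y2
    proof -
      have eq: "a - (2 * ((a + b) / 2) - y1) = - (b - y1)" "b - (2 * ((a + b) / 2) - y1) = - (a - y1)"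
        by (simp_all add: field_simps)
      have "u - v = - (v - u)" for u v :: real by simp
      then show ?thesis unfolding eq fst_conv snd_conv power2_minus .
    qed
    show "?p a (y1, y2) - ?p b (y1, y2) > 0" if "y1 < (a + b) / 2" "y2 > 0" for y1 y2
    proof -
      have "(b - y1)\<^sup>2 - (a - y1)\<^sup>2 = (b - a) * (a + b - 2 * y1)"
        by (simp add: power2_eq_square algebra_simps)
      moreover have "\<dots> > 0" using that assms by simp
      ultimately have "y2 / ((b - y1)\<^sup>2 + y2\<^sup>2) < y2 / ((a - y1)\<^sup>2 + y2\<^sup>2)"
        using that by (intro divide_strict_left_mono mult_pos_pos add_nonneg_pos) auto
      then show ?thesis by simp
    qed
    show "(a + b) / 2 > 0" using assms by simp
  qed measurable
  also have "(LINT y|lborel. indicat_real \<Omega> y * (?p a y - ?p b y)) =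
      (LINT y|lborel. indicat_real \<Omega> y * ?p a y) - (LINT y|lborel. indicat_real \<Omega> y * ?p b y)"
    unfolding right_diff_distrib
    by (rule Bochner_Integration.integral_diff[OF integrable_poisson integrable_poisson])
  finally show ?thesis
    by (simp only: axis_speed_eq) (intro divide_strict_right_mono, simp_all)
qed

lemma axis_speed_even: "axis_speed (- a) = axis_speed a"
proof -
  let ?g = "\<lambda>y. indicat_real \<Omega> y * (snd y / ((- a - fst y)\<^sup>2 + (snd y)\<^sup>2))"
  have "(LINT y|lborel. ?g (0 + (- 1) * fst y, 0 + 1 * snd y)) = (LINT y|lborel. ?g y)"
    by (rule integral_axis_isometry) auto
  moreover have "?g (0 + (- 1) * fst y, 0 + 1 * snd y) =
      indicat_real \<Omega> y * (snd y / ((a - fst y)\<^sup>2 + (snd y)\<^sup>2))" for y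
    using fst_symmetric[of "fst y" "snd y"] by (simp add: indicator_def power2_commute)
  ultimately show ?thesis by (simp add: axis_speed_eq)
qed

lemma axis_speed_less:
  assumes "\<bar>a\<bar> < \<bar>b\<bar>"
  shows "axis_speed b < axis_speed a"
proof -
  have "axis_speed \<bar>t\<bar> = axis_speed t" for t by (auto simp: abs_if axis_speed_even)
  then show ?thesis using axis_speed_strict_decreasing[of "\<bar>a\<bar>" "\<bar>b\<bar>"] assms by simp
qed

lemma continuous_on_axis_speed: "continuous_on S axis_speed"
  unfolding axis_speed_def
  by (intro continuous_on_snd continuous_on_compose2[OF continuous_on_d\<psi>[of UNIV]] continuous_intros) auto

end

section \<open>Mean of the vertical derivative over the patch\<close>

context steiner_patch
begin

lemma DERIV_\<psi>_fst: "((\<lambda>t. \<psi> (t, s)) has_real_derivative fst (d\<psi> (a, s))) (at a)"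
proof -
  have "((\<lambda>t. \<psi> (t, s)) has_derivative (\<lambda>h. d\<psi> (a, s) \<bullet> (h, 0))) (at a)"
    by (rule has_derivative_compose[OF _ has_derivative_\<psi>]) (auto intro!: derivative_eq_intros)
  then show ?thesis by (simp add: has_field_derivative_def inner_prod_def mult_commute_abs)
qed

lemma DERIV_\<psi>_snd: "((\<lambda>t. \<psi> (a, t)) has_real_derivative snd (d\<psi> (a, s))) (at s)"
proof -
  have "((\<lambda>t. \<psi> (a, t)) has_derivative (\<lambda>h. d\<psi> (a, s) \<bullet> (0, h))) (at s)"
    by (rule has_derivative_compose[OF _ has_derivative_\<psi>]) (auto intro!: derivative_eq_intros)
  then show ?thesis by (simp add: has_field_derivative_def inner_prod_def mult_commute_abs)
qed

lemma not_negligible_patch: "\<not> negligible \<Omega>"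
  using open_not_negligible[OF open_patch nonempty] .

lemma measure_patch_pos: "measure lborel \<Omega> > 0"
proof -
  have "emeasure lborel \<Omega> \<noteq> 0"
    using not_negligible_patch
    by (auto simp: negligible_iff_null_sets null_sets_def intro: null_sets_completionI)
  moreover have "emeasure lborel \<Omega> < \<infinity>"
    using emeasure_bounded_finite[OF bounded_patch] .
  ultimately show ?thesis
    by (simp add: measure_def enn2real_positive_iff zero_less_iff_neq_zero)
qed

text \<open>Tonelli, with inner integrals bounded uniformly in x by the kernel of order 1. The map
  \<open>T\<close> is the identity for the interaction of the patch with itself and
  \<open>mirror\<close> for the interaction with its image.\<close>

lemma integrable_pair:
  fixes k :: "real \<times> real \<Rightarrow> real \<times> real \<Rightarrow> real"
  assumes [measurable]: "case_prod k \<in> borel_measurable (lborel \<Otimes>\<^sub>M lborel)"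
    and le: "\<And>x y. x \<in> \<Omega> \<Longrightarrow> y \<in> \<Omega> \<Longrightarrow> \<bar>k x y\<bar> \<le> 1 / norm (T x - y)"
  shows "integrable (lborel \<Otimes>\<^sub>M lborel) (\<lambda>(x, y). indicat_real \<Omega> x * (indicat_real \<Omega> y * k x y))"
proof -
  let ?f = "\<lambda>(x, y). indicat_real \<Omega> x * (indicat_real \<Omega> y * k x y)"
  have [measurable]: "k x \<in> borel_measurable borel" for x
    using measurable_Pair2[OF assms(1), of x] by simp
  have ker: "integrable lborel (\<lambda>y. indicat_real \<Omega> y / norm (x - y))" for x
    using riesz_integrable[of 1 x] by (simp add: powr_minus_one_real)
  obtain M where M: "M \<ge> 0"
    "\<And>x. (LINT y|lborel. indicat_real \<Omega> y * norm (x - y) powr - 1) \<le> M"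
    by (rule riesz_bounded[of 1], simp, simp, rule that)
  have f_le: "norm (?f (x, y)) \<le> indicat_real \<Omega> x * (indicat_real \<Omega> y / norm (T x - y))" for x y
    using le[of x y] by (auto simp: indicator_def)
  have f_int: "integrable lborel (\<lambda>y. ?f (x, y))" for x
  proof (rule Bochner_Integration.integrable_bound)
    show "integrable lborel (\<lambda>y. indicat_real \<Omega> x * (indicat_real \<Omega> y / norm (T x - y)))"
      using ker by (intro integrable_mult_right)
    show "AE y in lborel. norm (?f (x, y)) \<le> norm (indicat_real \<Omega> x * (indicat_real \<Omega> y / norm (T x - y)))"
      using f_le by (auto intro: order_trans)
    show "(\<lambda>y. ?f (x, y)) \<in> borel_measurable lborel"
      unfolding prod.case by measurable
  qed
  show ?thesis
  proof (rule lborel_pair.Fubini_integrable)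
    show "integrable lborel (\<lambda>x. LINT y|lborel. norm (?f (x, y)))"
    proof (rule Bochner_Integration.integrable_bound)
      show "integrable lborel (\<lambda>x. M * indicat_real \<Omega> x)"
        using integrable_indicator by (intro integrable_mult_right)
      have "(LINT y|lborel. norm (?f (x, y))) \<le> M * indicat_real \<Omega> x" for x
      proof -
        have "(LINT y|lborel. norm (?f (x, y))) \<le>
            (LINT y|lborel. indicat_real \<Omega> x * (indicat_real \<Omega> y / norm (T x - y)))"
          using f_int f_le ker
          by (intro integral_mono integrable_norm integrable_mult_right) auto
        also have "\<dots> = indicat_real \<Omega> x * (LINT y|lborel. indicat_real \<Omega> y / norm (T x - y))"
          by (rule integral_mult_right_zero)
        also have "\<dots> \<le> indicat_real \<Omega> x * M"
          using M(2)[of "T x"] by (intro mult_left_mono) (auto simp: powr_minus_one_real)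
        finally show ?thesis by (simp add: mult.commute)
      qed
      then show "AE x in lborel. norm (LINT y|lborel. norm (?f (x, y))) \<le> norm (M * indicat_real \<Omega> x)"
        using M(1) by simp
    qed measurable
    show "AE x in lborel. integrable lborel (\<lambda>y. ?f (x, y))"
      using f_int by simp
  qed measurable
qed

text \<open>Fubini in the form needed for symmetrizing: a kernel and its transpose have the same
  double integral over the patch.\<close>

lemma pair_integral_swap:
  fixes k :: "real \<times> real \<Rightarrow> real \<times> real \<Rightarrow> real"
  assumes "integrable (lborel \<Otimes>\<^sub>M lborel) (\<lambda>(x, y). indicat_real \<Omega> x * (indicat_real \<Omega> y * k x y))"
  shows "(LINT x|lborel. indicat_real \<Omega> x * (LINT y|lborel. indicat_real \<Omega> y * k y x)) =
    (LINT x|lborel. indicat_real \<Omega> x * (LINT y|lborel. indicat_real \<Omega> y * k x y))"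
  using lborel_pair.Fubini_integral[OF assms]
  by (simp add: mult.left_commute[of "indicat_real \<Omega> _" "indicat_real \<Omega> _"])

lemma integrable_pair_outer:
  fixes k :: "real \<times> real \<Rightarrow> real \<times> real \<Rightarrow> real"
  assumes "integrable (lborel \<Otimes>\<^sub>M lborel) (\<lambda>(x, y). indicat_real \<Omega> x * (indicat_real \<Omega> y * k x y))"
  shows "integrable lborel (\<lambda>x. indicat_real \<Omega> x * (LINT y|lborel. indicat_real \<Omega> y * k x y))"
  using lborel_pair.integrable_fst'[OF assms] by simp

lemma integrable_axis_speed: "integrable lborel (\<lambda>x. indicat_real \<Omega> x * axis_speed (fst x))"
proof -
  obtain M where M: "\<And>x. norm (d\<psi> x) \<le> M" by (rule d\<psi>_bounded, rule that)
  have [measurable]: "axis_speed \<in> borel_measurable borel"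
    by (intro borel_measurable_continuous_onI continuous_on_axis_speed)
  show ?thesis
  proof (rule Bochner_Integration.integrable_bound)
    show "integrable lborel (\<lambda>x. M * indicat_real \<Omega> x)"
      using integrable_indicator by (intro integrable_mult_right)
    have "\<bar>axis_speed a\<bar> \<le> \<bar>M\<bar>" for a
      using norm_snd_le[of "snd (d\<psi> (a, 0))" "fst (d\<psi> (a, 0))"] M[of "(a, 0)"]
      by (simp add: axis_speed_def)
    then show "AE x in lborel. norm (indicat_real \<Omega> x * axis_speed (fst x)) \<le> norm (M * indicat_real \<Omega> x)"
      by (simp add: indicator_def)
  qed measurable
qed

text \<open>The patch does not move itself on average, since \<open>k1\<close> is antisymmetric; its mean speed comes
  from the mirror image, whose kernel \<open>k2 x y + k2 y x\<close> may be replaced by \<open>2 * k2 x y\<close>.\<close>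

lemma mean_speed_le:
  "(LINT x|lborel. indicat_real \<Omega> x * snd (d\<psi> x)) \<le> (LINT x|lborel. indicat_real \<Omega> x * axis_speed (fst x))"
proof -
  \<comment> \<open>\<open>D x y\<close> is the squared distance from y to the mirror image of x,
    and it is symmetric. The image kernel (x2 + y2)/D splits into \<open>k2 x y + k2 y x\<close>;
    \<open>k2\<close> carries y2 in the numerator, so lowering its denominator produces the Poisson
    kernel.\<close>
  define D where "D x y = (fst x - fst y)\<^sup>2 + (snd x + snd y)\<^sup>2" for x y :: "real \<times> real"
  define k1 where "k1 x y = snd (inversion (x - y))" for x y :: "real \<times> real"
  define k2 where "k2 x y = snd y / D x y" for x y
  define I where "I k x = (LINT y|lborel. indicat_real \<Omega> y * k x y)"
    for k :: "real \<times> real \<Rightarrow> real \<times> real \<Rightarrow> real" and x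
  define II where "II k = (LINT x|lborel. indicat_real \<Omega> x * I k x)" for k
  let ?k3 = "\<lambda>x y. k2 y x"
  have D: "D x y = D y x" "D x y = (norm (mirror x - y))\<^sup>2" for x y
    by (simp_all add: D_def norm_prod_def power2_commute[of "fst y"] add.commute mirror_def minus_prod_def)
       (simp add: power2_eq_square algebra_simps)
  have k1_le: "\<bar>k1 x y\<bar> \<le> 1 / norm (id x - y)" for x y
    using norm_snd_le[of "snd (inversion (x - y))" "fst (inversion (x - y))"]
    by (simp add: k1_def norm_inversion)
  \<comment> \<open>Both heights are positive and hence at most |mirror x - y|; this cancels one
    power of the distance in D.\<close>
  have k2_le: "\<bar>k2 x y\<bar> \<le> 1 / norm (mirror x - y) \<and> \<bar>k2 y x\<bar> \<le> 1 / norm (mirror x - y)"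
    if "x \<in> \<Omega>" "y \<in> \<Omega>" for x y
  proof -
    have s: "snd x > 0" "snd y > 0" using that by (auto simp: in_patch_iff)
    have "\<bar>- snd x - snd y\<bar> \<le> norm (mirror x - y)"
      using norm_snd_le[of "snd (mirror x - y)" "fst (mirror x - y)"]
      unfolding prod.collapse by simp
    then have le: "snd x \<le> norm (mirror x - y)" "snd y \<le> norm (mirror x - y)" and n: "norm (mirror x - y) > 0"
      using s by linarith+
    have "t / n\<^sup>2 \<le> 1 / n" if "t \<le> n" "n > 0" for t n :: real
      using that by (simp add: power2_eq_square divide_simps)
    from this[OF le(1) n] this[OF le(2) n] show ?thesis
      using s unfolding k2_def D(1)[of y x] unfolding D(2) by simp
  qed
  have [measurable]: "case_prod k1 \<in> borel_measurable (lborel \<Otimes>\<^sub>M lborel)"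
    "case_prod k2 \<in> borel_measurable (lborel \<Otimes>\<^sub>M lborel)"
    "case_prod ?k3 \<in> borel_measurable (lborel \<Otimes>\<^sub>M lborel)"
    unfolding k1_def k2_def D_def snd_inversion by measurable
  have int1: "integrable (lborel \<Otimes>\<^sub>M lborel) (\<lambda>(x, y). indicat_real \<Omega> x * (indicat_real \<Omega> y * k1 x y))"
    by (rule integrable_pair) (auto intro: k1_le)
  have int2: "integrable (lborel \<Otimes>\<^sub>M lborel) (\<lambda>(x, y). indicat_real \<Omega> x * (indicat_real \<Omega> y * k2 x y))"
    by (rule integrable_pair[where T = mirror]) (use k2_le in auto)
  have int3: "integrable (lborel \<Otimes>\<^sub>M lborel) (\<lambda>(x, y). indicat_real \<Omega> x * (indicat_real \<Omega> y * ?k3 x y))"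
    by (rule integrable_pair[where T = mirror]) (use k2_le in auto)
  have k2_int: "integrable lborel (\<lambda>y. indicat_real \<Omega> y * k2 x y)"
    and k3_int: "integrable lborel (\<lambda>y. indicat_real \<Omega> y * k2 y x)" if x: "x \<in> \<Omega>" for x
  proof -
    have ker: "integrable lborel (\<lambda>y. indicat_real \<Omega> y / norm (mirror x - y))"
      using riesz_integrable[of 1 "mirror x"] by (simp add: powr_minus_one_real)
    show "integrable lborel (\<lambda>y. indicat_real \<Omega> y * k2 x y)"
      by (rule Bochner_Integration.integrable_bound[OF ker])
         (use k2_le[OF x] in \<open>auto simp: indicator_def intro!: AE_I2\<close>)
    show "integrable lborel (\<lambda>y. indicat_real \<Omega> y * k2 y x)"
      by (rule Bochner_Integration.integrable_bound[OF ker])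
         (use k2_le[OF x] in \<open>auto simp: indicator_def intro!: AE_I2\<close>)
  qed
  have II1: "II k1 = 0"
  proof -
    have swap: "II (\<lambda>x y. k1 y x) = II k1"
      unfolding II_def I_def by (rule pair_integral_swap[OF int1])
    have anti: "k1 y x = - k1 x y" for x y
    proof -
      have "inversion (- z) = - inversion z" for z :: "real \<times> real" by (simp add: inversion_def)
      from this[of "x - y"] show ?thesis by (simp add: k1_def)
    qed
    have "(\<lambda>x y. k1 y x) = (\<lambda>x y. - k1 x y)" by (intro ext) (rule anti)
    with swap have "II (\<lambda>x y. - k1 x y) = II k1" by (simp only:)
    then show ?thesis by (simp add: II_def I_def)
  qed
  have II3: "II ?k3 = II k2"
    unfolding II_def I_def by (rule pair_integral_swap[OF int2])
  have d\<psi>: "snd (d\<psi> x) = (I k2 x + I ?k3 x - I k1 x) / (2 * pi)" if "x \<in> \<Omega>" for x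
  proof -
    have "- snd (log_grad (mirror x)) = (LINT y|lborel. indicat_real \<Omega> y * k2 x y + indicat_real \<Omega> y * k2 y x)"
      unfolding snd_log_grad Bochner_Integration.integral_minus[symmetric]
    proof (intro Bochner_Integration.integral_cong refl)
      fix y :: "real \<times> real"
      have "(- snd x - snd y)\<^sup>2 = (snd x + snd y)\<^sup>2"
        by (simp add: power2_eq_square algebra_simps)
      then have "snd (inversion (mirror x - y)) = (- snd x - snd y) / D x y"
        by (simp add: snd_inversion D_def)
      then have "- snd (inversion (mirror x - y)) = k2 x y + k2 y x"
        by (simp add: k2_def D(1)[of y x] diff_divide_distrib)
      then show "- (indicat_real \<Omega> y * snd (inversion (mirror x - y))) =
          indicat_real \<Omega> y * k2 x y + indicat_real \<Omega> y * k2 y x"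
        by (metis distrib_left mult_minus_right)
    qed
    also have "\<dots> = I k2 x + I ?k3 x"
      unfolding I_def by (rule Bochner_Integration.integral_add[OF k2_int[OF that] k3_int[OF that]])
    finally show ?thesis by (simp add: d\<psi>_def snd_log_grad I_def k1_def field_simps)
  qed
  have outer: "integrable lborel (\<lambda>x. indicat_real \<Omega> x * I k1 x)"
    "integrable lborel (\<lambda>x. indicat_real \<Omega> x * I k2 x)"
    "integrable lborel (\<lambda>x. indicat_real \<Omega> x * I ?k3 x)"
    unfolding I_def by (rule integrable_pair_outer[OF int1] integrable_pair_outer[OF int2]
        integrable_pair_outer[OF int3])+
  have "(LINT x|lborel. indicat_real \<Omega> x * snd (d\<psi> x)) =
      (LINT x|lborel. (indicat_real \<Omega> x * I k2 x + indicat_real \<Omega> x * I ?k3 x - indicat_real \<Omega> x * I k1 x) / (2 * pi))"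
    by (intro Bochner_Integration.integral_cong refl) (simp add: d\<psi> indicator_def)
  also have "\<dots> = (II k2 + II ?k3 - II k1) / (2 * pi)"
    using outer by (simp add: II_def)
  also have "\<dots> = (LINT x|lborel. indicat_real \<Omega> x * (I k2 x / pi))"
    unfolding II1 II3 by (simp add: II_def)
  also have "\<dots> \<le> (LINT x|lborel. indicat_real \<Omega> x * axis_speed (fst x))"
  proof (rule integral_mono)
    show "integrable lborel (\<lambda>x. indicat_real \<Omega> x * (I k2 x / pi))"
      using outer(2) by simp
    show "integrable lborel (\<lambda>x. indicat_real \<Omega> x * axis_speed (fst x))"
      by (rule integrable_axis_speed)
    show "indicat_real \<Omega> x * (I k2 x / pi) \<le> indicat_real \<Omega> x * axis_speed (fst x)" for x
    proof (cases "x \<in> \<Omega>")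
      case True
      have "I k2 x \<le> (LINT y|lborel. indicat_real \<Omega> y * (snd y / ((fst x - fst y)\<^sup>2 + (snd y)\<^sup>2)))"
        unfolding I_def
      proof (rule integral_mono[OF k2_int[OF True] integrable_poisson])
        fix y
        show "indicat_real \<Omega> y * k2 x y \<le> indicat_real \<Omega> y * (snd y / ((fst x - fst y)\<^sup>2 + (snd y)\<^sup>2))"
        proof (cases "y \<in> \<Omega>")
          case y: True
          then have "snd x > 0" "snd y > 0" using True by (auto simp: in_patch_iff)
          then have "k2 x y \<le> snd y / ((fst x - fst y)\<^sup>2 + (snd y)\<^sup>2)"
            unfolding k2_def D_def
            by (intro divide_left_mono add_left_mono power_mono mult_pos_pos add_nonneg_pos) auto
          then show ?thesis using y by simp
        qed simp
      qed
      then have "I k2 x / pi \<le> axis_speed (fst x)"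
        unfolding axis_speed_eq by (intro divide_right_mono) auto
      then show ?thesis using True by simp
    qed simp
  qed
  finally show ?thesis .
qed

text \<open>The maximum of \<open>axis_speed\<close> is attained only at 0, hence only on a null set
  of x, whereas the patch has positive measure.\<close>

lemma mean_axis_speed_less:
  "(LINT x|lborel. indicat_real \<Omega> x * axis_speed (fst x)) < axis_speed 0 * measure lborel \<Omega>"
proof -
  let ?g = "\<lambda>x. indicat_real \<Omega> x * axis_speed 0 - indicat_real \<Omega> x * axis_speed (fst x)"
  have g_int: "integrable lborel ?g"
    using integrable_axis_speed integrable_indicator by (intro Bochner_Integration.integrable_diff integrable_mult_left) auto
  have le: "axis_speed a \<le> axis_speed 0" for a
    using axis_speed_less[of 0 a] by (cases "a = 0") auto
  then have g_nonneg: "?g x \<ge> 0" for x by (simp add: indicator_def)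
  have "integral\<^sup>L lborel ?g \<noteq> 0"
  proof
    assume "integral\<^sup>L lborel ?g = 0"
    then have "AE x in lborel. ?g x = 0"
      using integral_nonneg_eq_0_iff_AE[OF g_int] g_nonneg by simp
    then have "AE x in lborel. x \<notin> \<Omega>"
      using AE_fst_neq[of 0]
    proof eventually_elim
      case (elim x)
      then show ?case using axis_speed_less[of 0 "fst x"] by auto
    qed
    then have "\<Omega> \<in> null_sets lborel" by (subst (asm) AE_iff_null_sets[symmetric]) auto
    then show False
      using not_negligible_patch by (simp add: negligible_iff_null_sets null_sets_completionI)
  qed
  moreover have "integral\<^sup>L lborel ?g \<ge> 0" using g_nonneg by simp
  moreover have "integral\<^sup>L lborel ?g =
      axis_speed 0 * measure lborel \<Omega> - (LINT x|lborel. indicat_real \<Omega> x * axis_speed (fst x))"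
    using integrable_axis_speed integrable_indicator by (simp add: mult.commute)
  ultimately show ?thesis by linarith
qed

end

section \<open>The boundary of a traveling patch\<close>

text \<open>The function g is given and continuous, so differentiability of f at a single point
  suffices. Writing G and T for the increments of g and t, the level condition gives kG + mT = o(|G|
  + |T|); absorbing the G term yields |G| \<le> K |T|, and inserting this back leaves
  o(|T|).\<close>

lemma has_real_derivative_implicit:
  fixes f :: "real \<times> real \<Rightarrow> real" and g :: "real \<Rightarrow> real"
  assumes f: "(f has_derivative (\<lambda>h. d \<bullet> h)) (at (g s, s))" and d: "fst d \<noteq> 0"
    and g: "isCont g s" and level: "\<forall>\<^sub>F t in at s. f (g t, t) = f (g s, s)"
  shows "(g has_real_derivative - (snd d / fst d)) (at s)"
proof -
  define k m where "k = fst d" and "m = snd d"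
  \<comment> \<open>Solve |k| |G| \<le> |m| |T| + (|k|/2) (|G| + |T|) for |G|.\<close>
  define K where "K = (2 * \<bar>m\<bar> + \<bar>k\<bar>) / \<bar>k\<bar>"
  have k: "\<bar>k\<bar> > 0" and K: "K \<ge> 0" "\<bar>k\<bar> * K = 2 * \<bar>m\<bar> + \<bar>k\<bar>"
    using d by (auto simp: k_def K_def)
  have "((\<lambda>t. (g t - g s) / (t - s)) \<longlongrightarrow> - (m / k)) (at s)"
  proof (rule tendstoI)
    fix \<eta> :: real assume "\<eta> > 0"
    \<comment> \<open>The first bound on e permits the absorption, the second makes the final error
      at most half of \<eta>.\<close>
    define e where "e = min (\<bar>k\<bar> / 2) (\<eta> / 2 * \<bar>k\<bar> / (K + 1))"
    have e: "e > 0" "e \<le> \<bar>k\<bar> / 2" "e * (K + 1) \<le> \<eta> / 2 * \<bar>k\<bar>"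
    proof -
      show "e > 0" using k K \<open>\<eta> > 0\<close> by (simp add: e_def)
      show "e \<le> \<bar>k\<bar> / 2" unfolding e_def by (rule min.cobounded1)
      have "e \<le> \<eta> / 2 * \<bar>k\<bar> / (K + 1)" unfolding e_def by (rule min.cobounded2)
      then show "e * (K + 1) \<le> \<eta> / 2 * \<bar>k\<bar>" using K by (simp add: pos_le_divide_eq algebra_simps)
    qed
    obtain \<delta> where "\<delta> > 0" and \<delta>: "\<And>y. norm (y - (g s, s)) < \<delta> \<Longrightarrow>
        \<bar>f y - f (g s, s) - d \<bullet> (y - (g s, s))\<bar> \<le> e * norm (y - (g s, s))"
      using f \<open>e > 0\<close> unfolding has_derivative_at_alt by (auto simp: real_norm_def)
    have "((\<lambda>t. (g t, t)) \<longlongrightarrow> (g s, s)) (at s)"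
      using g by (intro tendsto_intros) (auto simp: isCont_def)
    from tendstoD[OF this \<open>\<delta> > 0\<close>] level
    show "\<forall>\<^sub>F t in at s. dist ((g t - g s) / (t - s)) (- (m / k)) < \<eta>"
      unfolding eventually_at_filter
    proof eventually_elim
      case (elim t)
      show ?case
      proof (intro impI)
        assume "t \<noteq> s"
        define G T where "G = g t - g s" and "T = t - s"
        have "T \<noteq> 0" using \<open>t \<noteq> s\<close> by (simp add: T_def)
        have "norm ((g t, t) - (g s, s)) < \<delta>" and eq: "f (g t, t) = f (g s, s)"
          using elim \<open>t \<noteq> s\<close> by (auto simp: dist_norm)
        from \<delta>[OF this(1)] have "\<bar>k * G + m * T\<bar> \<le> e * norm (G, T)"
          using eq by (simp add: inner_prod_def k_def m_def G_def T_def)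
        also have "\<dots> \<le> e * (\<bar>G\<bar> + \<bar>T\<bar>)"
          using norm_Pair_le[of G T] e by (intro mult_left_mono) auto
        finally have 1: "\<bar>k * G + m * T\<bar> \<le> e * (\<bar>G\<bar> + \<bar>T\<bar>)" .
        have "\<bar>k\<bar> * \<bar>G\<bar> \<le> \<bar>m\<bar> * \<bar>T\<bar> + e * (\<bar>G\<bar> + \<bar>T\<bar>)"
          using 1 by (simp add: abs_mult[symmetric])
        also have "\<dots> \<le> \<bar>m\<bar> * \<bar>T\<bar> + \<bar>k\<bar> / 2 * (\<bar>G\<bar> + \<bar>T\<bar>)"
          using e by (intro add_left_mono mult_right_mono) auto
        finally have "\<bar>k\<bar> * \<bar>G\<bar> \<le> (2 * \<bar>m\<bar> + \<bar>k\<bar>) * \<bar>T\<bar>" by (simp add: field_simps)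
        also have "\<dots> = \<bar>k\<bar> * (K * \<bar>T\<bar>)" using K by simp
        finally have "\<bar>G\<bar> \<le> K * \<bar>T\<bar>" using k by simp
        then have "e * (\<bar>G\<bar> + \<bar>T\<bar>) \<le> e * (K * \<bar>T\<bar> + \<bar>T\<bar>)"
          using e by (intro mult_left_mono) auto
        also have "\<dots> = e * (K + 1) * \<bar>T\<bar>" by (simp add: algebra_simps)
        also have "\<dots> \<le> \<eta> / 2 * \<bar>k\<bar> * \<bar>T\<bar>" using e by (intro mult_right_mono) auto
        finally have 2: "\<bar>k * G + m * T\<bar> \<le> \<eta> / 2 * \<bar>k * T\<bar>" using 1 by (simp add: abs_mult)
        have "k * T \<noteq> 0" using k \<open>T \<noteq> 0\<close> by simp
        then have "\<bar>(k * G + m * T) / (k * T)\<bar> \<le> \<eta> / 2"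
          using 2 by (simp add: pos_divide_le_eq)
        moreover have "(k * G + m * T) / (k * T) = G / T - - (m / k)"
          using k \<open>T \<noteq> 0\<close> by (simp add: field_simps)
        ultimately have "\<bar>G / T - - (m / k)\<bar> \<le> \<eta> / 2" by (simp only:)
        then show "dist ((g t - g s) / (t - s)) (- (m / k)) < \<eta>"
          using \<open>\<eta> > 0\<close> by (simp add: dist_real_def G_def T_def)
      qed
    qed
  qed
  then show ?thesis by (simp add: has_field_derivative_iff k_def m_def)
qed

lemma quotient_difference_le:
  fixes a b a' b' :: real
  assumes "\<bar>a - a'\<bar> \<le> \<delta>" "\<bar>b - b'\<bar> \<le> \<delta>" "\<bar>a'\<bar> \<le> N" "\<mu> \<le> \<bar>b\<bar>" "\<mu> \<le> \<bar>b'\<bar>" "\<mu> > 0"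
  shows "\<bar>a / b - a' / b'\<bar> \<le> (1 / \<mu> + N / \<mu>\<^sup>2) * \<delta>"
proof -
  have nz: "b \<noteq> 0" "b' \<noteq> 0" using assms by auto
  have "a / b - a' / b' = (a - a') / b + a' * (b' - b) / (b * b')"
    using nz by (simp add: field_simps)
  also have "\<bar>\<dots>\<bar> \<le> \<bar>a - a'\<bar> / \<bar>b\<bar> + \<bar>a'\<bar> * \<bar>b' - b\<bar> / (\<bar>b\<bar> * \<bar>b'\<bar>)"
    by (metis abs_triangle_ineq abs_divide abs_mult)
  also have "\<dots> \<le> \<delta> / \<mu> + N * \<delta> / (\<mu> * \<mu>)"
    using assms by (intro add_mono frac_le mult_mono mult_pos_pos) (auto simp: abs_minus_commute)
  finally show ?thesis by (simp add: algebra_simps power2_eq_square)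
qed

locale traveling_patch = steiner_patch +
  fixes W :: real
  assumes level: "x \<in> half_plane \<Longrightarrow> x \<in> \<Omega> \<longleftrightarrow> W * snd x < \<psi> x"
    and l_nonneg: "s > 0 \<Longrightarrow> l s \<ge> 0"
begin

text \<open>The stream function in the frame moving with the patch.\<close>

definition F :: "real \<times> real \<Rightarrow> real" where "F x = \<psi> x - W * snd x"

lemma level_F: "s > 0 \<Longrightarrow> (a, s) \<in> \<Omega> \<longleftrightarrow> F (a, s) > 0"
  using level[of "(a, s)"] by (simp add: half_plane_def F_def)

lemma F_axis: "F (a, 0) = 0"
  by (simp add: F_def \<psi>_axis)

lemma continuous_on_F: "continuous_on S F"
  unfolding F_def by (intro continuous_intros continuous_on_\<psi>)

lemma DERIV_F_fst: "((\<lambda>t. F (t, s)) has_real_derivative fst (d\<psi> (a, s))) (at a)"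
  unfolding F_def using DERIV_\<psi>_fst[of s a] by (auto intro!: derivative_eq_intros)

lemma DERIV_F_snd: "((\<lambda>t. F (a, t)) has_real_derivative snd (d\<psi> (a, s)) - W) (at s)"
  unfolding F_def using DERIV_\<psi>_snd[of a s] by (auto intro!: derivative_eq_intros)

lemma F_strict_decreasing:
  assumes "0 \<le> a" "a < b" "s > 0"
  shows "F (b, s) < F (a, s)"
\<comment> \<open>A sign in the open interval must suffice: when a = 0 the derivative vanishes at
  the left endpoint by symmetry.\<close>
proof (rule DERIV_neg_imp_decreasing_open[OF \<open>a < b\<close>])
  show "\<exists>y. ((\<lambda>t. F (t, s)) has_real_derivative y) (at x) \<and> y < 0" if "a < x" "x < b" for x
    using DERIV_F_fst[of s x] fst_d\<psi>_neg[of x s] that assms by auto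
  show "continuous_on {a..b} (\<lambda>t. F (t, s))"
    by (intro continuous_on_compose2[OF continuous_on_F[of UNIV]] continuous_intros) auto
qed

text \<open>The constant is uniform in a; it supplies the dominating function for the difference
  quotients below.\<close>

lemma F_vertical_lipschitz: obtains K where "K \<ge> 0" "\<And>a s t. \<bar>F (a, s) - F (a, t)\<bar> \<le> K * \<bar>s - t\<bar>"
proof -
  obtain M where M: "\<And>x. norm (d\<psi> x) \<le> M" by (rule d\<psi>_bounded, rule that)
  have "M \<ge> 0" using M[of 0] norm_ge_zero order_trans by blast
  have "\<bar>F (a, s) - F (a, t)\<bar> \<le> (M + \<bar>W\<bar>) * \<bar>s - t\<bar>" for a s t
    unfolding real_norm_def[symmetric]
  proof (rule field_differentiable_bound[of UNIV])
    show "((\<lambda>t. F (a, t)) has_field_derivative snd (d\<psi> (a, u)) - W) (at u within UNIV)" for u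
      using DERIV_F_snd by simp
    show "norm (snd (d\<psi> (a, u)) - W) \<le> M + norm W" for u
      using norm_triangle_ineq4[of "snd (d\<psi> (a, u))" W] M[of "(a, u)"]
        norm_snd_le[of "snd (d\<psi> (a, u))" "fst (d\<psi> (a, u))"] by simp
  qed auto
  then show thesis using that[of "M + \<bar>W\<bar>"] \<open>M \<ge> 0\<close> by simp
qed

text \<open>Compare the positive part \<open>G\<close> of \<open>F\<close> with its vertical translates, which have the
  same integral: the difference quotients of \<open>G\<close> are at most those of \<open>F\<close> on
  \<open>\<Omega>\<close> and nonpositive elsewhere.\<close>

lemma vertical_flux_nonneg: "0 \<le> (LINT x|lborel. indicat_real \<Omega> x * (snd (d\<psi> x) - W))"
proof -
  obtain K where K: "K \<ge> 0" "\<And>a s t. \<bar>F (a, s) - F (a, t)\<bar> \<le> K * \<bar>s - t\<bar>"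
    by (rule F_vertical_lipschitz, rule that)
  define G where "G x = indicat_real \<Omega> x * F x" for x
  define h where "h n = 1 / real (Suc n)" for n
  \<comment> \<open>Backward quotients: discarding the points off the patch, where the quotient of
    \<open>G\<close> is nonpositive, can only raise the integral, which was 0.\<close>
  define q where "q n x = indicat_real \<Omega> x * ((F x - G (fst x, snd x - h n)) / h n)" for n x
  have h: "h n > 0" for n by (simp add: h_def)
  have h_lim: "h \<longlonglongrightarrow> 0" unfolding h_def using LIMSEQ_inverse_real_of_nat by (simp add: inverse_eq_divide)
  have [measurable]: "F \<in> borel_measurable borel"
    by (intro borel_measurable_continuous_onI continuous_on_F)
  have [measurable]: "(\<lambda>x. snd (d\<psi> x)) \<in> borel_measurable borel"
    by (intro borel_measurable_continuous_onI continuous_on_snd continuous_on_d\<psi>)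
  have [measurable]: "G \<in> borel_measurable borel" unfolding G_def by measurable
  have G_nonneg: "G x \<ge> 0" for x
    using level_F[of "snd x" "fst x"] by (auto simp: G_def indicator_def in_patch_iff)
  have G_int: "integrable lborel G"
  proof -
    have "compact (F ` closure \<Omega>)"
      using bounded_patch by (intro compact_continuous_image continuous_on_F) (simp add: compact_closure)
    then obtain B where B: "\<And>x. x \<in> \<Omega> \<Longrightarrow> \<bar>F x\<bar> \<le> B"
      using closure_subset[of \<Omega>] by (fastforce dest!: compact_imp_bounded simp: bounded_iff)
    show ?thesis
    proof (rule Bochner_Integration.integrable_bound)
      show "integrable lborel (\<lambda>x. B * indicat_real \<Omega> x)"
        using integrable_indicator by (intro integrable_mult_right)
      show "AE x in lborel. norm (G x) \<le> norm (B * indicat_real \<Omega> x)"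
        using B by (auto simp: G_def indicator_def intro!: AE_I2 order_trans[OF _ abs_ge_self])
    qed measurable
  qed
  have shift: "integrable lborel (\<lambda>x. G (fst x, snd x - h n))"
    "(LINT x|lborel. G (fst x, snd x - h n)) = (LINT x|lborel. G x)" for n
    using G_int integrable_axis_isometry[of 1 1 G 0 "- h n"] integral_axis_isometry[of 1 1 G 0 "- h n"]
    by simp_all
  have q_bound: "\<bar>q n x\<bar> \<le> K * indicat_real \<Omega> x" for n x
  proof (cases "x \<in> \<Omega>")
    case True
    obtain a s where x: "x = (a, s)" by (cases x)
    have s: "s > 0" and Fx: "F (a, s) > 0"
      using True level_F[of s a] by (auto simp: in_patch_iff x)
    have "\<bar>F (a, s) - G (a, s - h n)\<bar> \<le> K * h n"
    proof (cases "(a, s - h n) \<in> \<Omega>")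
      case True
      then show ?thesis using K(2)[of a s "s - h n"] h[of n] by (simp add: G_def)
    next
      case False
      have "F (a, s) \<le> K * h n"
      \<comment> \<open>The translated point may fall on or below the axis, where
        \<open>level_F\<close> is silent; then s \<le> h n, and F = 0 on the axis takes its
        place.\<close>
      proof (cases "s - h n > 0")
        case True
        then have "F (a, s - h n) \<le> 0" using False level_F by force
        then show ?thesis using K(2)[of a s "s - h n"] h[of n] by simp
      next
        case False
        have "F (a, s) \<le> K * s" using K(2)[of a s 0] s by (simp add: F_axis)
        also have "\<dots> \<le> K * h n" using False K by (intro mult_left_mono) auto
        finally show ?thesis .
      qed
      then show ?thesis using False Fx by (simp add: G_def)
    qed
    then show ?thesis using True h[of n] by (simp add: q_def x pos_divide_le_eq)
  qed (simp add: q_def)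
  have q_int: "integrable lborel (q n)" for n
  proof (rule Bochner_Integration.integrable_bound)
    show "integrable lborel (\<lambda>x. K * indicat_real \<Omega> x)"
      using integrable_indicator by (intro integrable_mult_right)
    show "AE x in lborel. norm (q n x) \<le> norm (K * indicat_real \<Omega> x)"
      using q_bound[of n] by (auto intro!: AE_I2 order_trans[OF _ abs_ge_self])
    show "q n \<in> borel_measurable lborel" unfolding q_def by measurable
  qed
  have "0 \<le> integral\<^sup>L lborel (q n)" for n
  proof -
    have "0 = (LINT x|lborel. (G x - G (fst x, snd x - h n)) / h n)"
      using shift[of n] G_int by simp
    also have "\<dots> \<le> integral\<^sup>L lborel (q n)"
    proof (rule integral_mono)
      show "(G x - G (fst x, snd x - h n)) / h n \<le> q n x" for x
        using G_nonneg[of "(fst x, snd x - h n)"] h[of n]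
        by (cases "x \<in> \<Omega>") (auto simp: q_def G_def divide_right_mono)
    qed (use shift G_int q_int in auto)
    finally show ?thesis .
  qed
  moreover have "(\<lambda>n. integral\<^sup>L lborel (q n)) \<longlonglongrightarrow> (LINT x|lborel. indicat_real \<Omega> x * (snd (d\<psi> x) - W))"
  proof (rule integral_dominated_convergence)
    show "integrable lborel (\<lambda>x. K * indicat_real \<Omega> x)"
      using integrable_indicator by (intro integrable_mult_right)
    show "AE x in lborel. norm (q n x) \<le> K * indicat_real \<Omega> x" for n
      using q_bound by simp
    show "q n \<in> borel_measurable lborel" for n using q_int by auto
    have "(\<lambda>n. q n x) \<longlonglongrightarrow> indicat_real \<Omega> x * (snd (d\<psi> x) - W)" for x
    proof (cases "x \<in> \<Omega>")
      case True
      obtain a s where x: "x = (a, s)" by (cases x)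
      have "((\<lambda>u. (F (a, s + u) - F (a, s)) / u) \<longlongrightarrow> snd (d\<psi> x) - W) (at 0)"
        using DERIV_F_snd[of a s] unfolding x by (rule DERIV_D)
      moreover have "filterlim (\<lambda>n. - h n) (at 0) sequentially"
        unfolding filterlim_at using h h_lim tendsto_minus[OF h_lim] by (simp add: less_imp_neq[symmetric])
      ultimately have "(\<lambda>n. (F (a, s + - h n) - F (a, s)) / (- h n)) \<longlonglongrightarrow> snd (d\<psi> x) - W"
        by (rule filterlim_compose)
      moreover have "\<forall>\<^sub>F n in sequentially. (F (a, s + - h n) - F (a, s)) / (- h n) = q n x"
      proof -
        \<comment> \<open>Openness of the patch makes \<open>G\<close> agree with \<open>F\<close>
          at the translated point for large n.\<close>
        have "(\<lambda>n. (a, s - h n)) \<longlonglongrightarrow> (a, s - 0)" by (intro tendsto_intros h_lim)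
        then have "\<forall>\<^sub>F n in sequentially. (a, s - h n) \<in> \<Omega>"
          using True open_patch x by (auto dest: topological_tendstoD)
        then show ?thesis
          by eventually_elim (use True in \<open>simp add: q_def G_def x minus_divide_left\<close>)
      qed
      ultimately have "(\<lambda>n. q n x) \<longlonglongrightarrow> snd (d\<psi> x) - W" by (rule Lim_transform_eventually)
      then show ?thesis using True by simp
    qed (simp add: q_def)
    then show "AE x in lborel. (\<lambda>n. q n x) \<longlonglongrightarrow> indicat_real \<Omega> x * (snd (d\<psi> x) - W)" by simp
  qed measurable
  ultimately show ?thesis by (auto intro: LIMSEQ_le_const)
qed

text \<open>Divide the three comparisons of integrals by the measure of the patch; the last one is
  strict.\<close>

lemma speed_less_axis_speed: "W < axis_speed 0"
proof -
  obtain M where M: "\<And>x. norm (d\<psi> x) \<le> M" by (rule d\<psi>_bounded, rule that)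
  have [measurable]: "(\<lambda>x. snd (d\<psi> x)) \<in> borel_measurable borel"
    by (intro borel_measurable_continuous_onI continuous_on_snd continuous_on_d\<psi>)
  have int: "integrable lborel (\<lambda>x. indicat_real \<Omega> x * snd (d\<psi> x))"
  proof (rule Bochner_Integration.integrable_bound)
    show "integrable lborel (\<lambda>x. M * indicat_real \<Omega> x)"
      using integrable_indicator by (intro integrable_mult_right)
    have "\<bar>snd (d\<psi> x)\<bar> \<le> \<bar>M\<bar>" for x
      using norm_snd_le[of "snd (d\<psi> x)" "fst (d\<psi> x)"] M[of x] by simp
    then show "AE x in lborel. norm (indicat_real \<Omega> x * snd (d\<psi> x)) \<le> norm (M * indicat_real \<Omega> x)"
      by (simp add: indicator_def)
  qed measurable
  have "W * measure lborel \<Omega> \<le> (LINT x|lborel. indicat_real \<Omega> x * snd (d\<psi> x))"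
    using vertical_flux_nonneg int integrable_indicator
    by (simp add: right_diff_distrib mult.commute)
  also note mean_speed_le
  also note mean_axis_speed_less
  finally show ?thesis using measure_patch_pos by simp
qed

text \<open>On the axis F is 0 and its upward derivative at (a, 0) is
  \<open>axis_speed a - W\<close>, so F becomes positive immediately above.\<close>

lemma axis_speed_gt_imp_patch:
  assumes "W < axis_speed a" shows "\<forall>\<^sub>F s in at_right 0. (a, s) \<in> \<Omega>"
proof -
  obtain d where "d > 0" "\<And>s. 0 < s \<Longrightarrow> s < d \<Longrightarrow> F (a, 0) < F (a, 0 + s)"
    using DERIV_pos_inc_right[OF DERIV_F_snd[of a 0]] assms by (auto simp: axis_speed_def)
  then show ?thesis
    unfolding eventually_at_right_field by (auto simp: level_F F_axis)
qed

lemma axis_speed_less_imp_not_patch: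
  assumes "axis_speed a < W" shows "\<forall>\<^sub>F s in at_right 0. (a, s) \<notin> \<Omega>"
proof -
  obtain d where "d > 0" "\<And>s. 0 < s \<Longrightarrow> s < d \<Longrightarrow> F (a, 0) > F (a, 0 + s)"
    using DERIV_neg_dec_right[OF DERIV_F_snd[of a 0]] assms by (auto simp: axis_speed_def)
  then show ?thesis
    unfolding eventually_at_right_field by (force simp: level_F F_axis)
qed

lemma boundary_limit: "\<exists>c>0. (l \<longlongrightarrow> c) (at_right 0)"
proof -
  obtain R where R: "\<And>y. y \<in> \<Omega> \<Longrightarrow> norm y \<le> R" and "R > 0"
    using bounded_patch unfolding bounded_pos by blast
  \<comment> \<open>No point of the patch has abscissa R + 1, so the axis speed cannot exceed W
    there. With W below the speed at 0, the intermediate value theorem provides c.\<close>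
  have "axis_speed (R + 1) \<le> W"
  proof (rule ccontr)
    assume "\<not> ?thesis"
    then have "\<forall>\<^sub>F s in at_right 0. (R + 1, s) \<in> \<Omega>" by (intro axis_speed_gt_imp_patch) simp
    then obtain s where "(R + 1, s) \<in> \<Omega>"
      using eventually_happens trivial_limit_at_right_real by blast
    then show False using R norm_fst_le[of "R + 1" s] by fastforce
  qed
  then obtain c where "0 \<le> c" and c: "axis_speed c = W"
    using IVT2'[of axis_speed "R + 1" W 0] speed_less_axis_speed \<open>R > 0\<close> continuous_on_axis_speed
    by auto
  then have "c > 0" using speed_less_axis_speed by (cases "c = 0") auto
  have pos: "\<forall>\<^sub>F s in at_right 0. s > (0 :: real)" by (rule eventually_at_right_less)
  have "(l \<longlongrightarrow> c) (at_right 0)"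
  proof (rule order_tendstoI)
    fix a assume "a < c"
    \<comment> \<open>Truncation at 0 treats negative a, where the even function
      \<open>axis_speed\<close> may lie below W.\<close>
    then have "W < axis_speed (max a 0)"
      using axis_speed_less[of "max a 0" c] c \<open>c > 0\<close> by auto
    from axis_speed_gt_imp_patch[OF this] pos show "\<forall>\<^sub>F s in at_right 0. a < l s"
      by eventually_elim (auto simp: in_patch_iff)
  next
    fix a assume "c < a"
    \<comment> \<open>A point (b, s) outside the patch gives only l s \<le> b; taking b strictly
      between c and a makes the bound strict.\<close>
    then have "axis_speed ((c + a) / 2) < W"
      using axis_speed_less[of c "(c + a) / 2"] c \<open>c > 0\<close> by auto
    from axis_speed_less_imp_not_patch[OF this] pos show "\<forall>\<^sub>F s in at_right 0. l s < a"
      by eventually_elim (use \<open>c < a\<close> \<open>c > 0\<close> in \<open>auto simp: in_patch_iff\<close>)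
  qed
  with \<open>c > 0\<close> show ?thesis by blast
qed

section \<open>Continuity and regularity of the boundary function\<close>

lemma F_boundary_nonpos: "s > 0 \<Longrightarrow> F (l s, s) \<le> 0"
  using level_F[of s "l s"] l_nonneg[of s] by (simp add: in_patch_iff)

text \<open>Lower semicontinuity is openness of the patch. For the upper one, strict decrease of F
  in x1 makes F negative, not merely nonpositive, beyond l(s), and this persists for nearby heights.
  Points with l(s) = 0 are included.\<close>

lemma isCont_boundary:
  assumes s: "s > 0" shows "isCont l s"
  unfolding isCont_def
proof (rule order_tendstoI)
  have pos: "\<forall>\<^sub>F t in at s. t > 0"
    using s by (intro order_tendstoD(1)[OF tendsto_ident_at])
  have lim: "((\<lambda>t. (b, t)) \<longlongrightarrow> (b, s)) (at s)" for b :: real by (intro tendsto_intros)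
  {
    fix a assume "a < l s"
    show "\<forall>\<^sub>F t in at s. a < l t"
    proof (cases "a < 0")
      case True
      from pos show ?thesis by eventually_elim (use True l_nonneg in force)
    next
      case False
      then have "(a, s) \<in> \<Omega>" using \<open>a < l s\<close> s by (simp add: in_patch_iff)
      from topological_tendstoD[OF lim open_patch this] show ?thesis
        by eventually_elim (auto simp: in_patch_iff)
    qed
  }
  fix a assume "l s < a"
  define b where "b = (l s + a) / 2"
  have b: "l s < b" "b < a" using \<open>l s < a\<close> by (auto simp: b_def)
  have "F (b, s) < F (l s, s)" using b s l_nonneg by (intro F_strict_decreasing) auto
  with F_boundary_nonpos[OF s] have "F (b, s) < 0" by simp
  moreover have "((\<lambda>t. F (b, t)) \<longlongrightarrow> F (b, s)) (at s)"
    using DERIV_isCont[OF DERIV_F_snd] by (simp add: isCont_def)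
  ultimately have "\<forall>\<^sub>F t in at s. F (b, t) < 0" by (intro order_tendstoD(2))
  with pos show "\<forall>\<^sub>F t in at s. l t < a"
  proof eventually_elim
    case (elim t)
    then have "(b, t) \<notin> \<Omega>" by (simp add: level_F)
    then show ?case using elim b l_nonneg[OF s] by (auto simp: in_patch_iff)
  qed
qed

lemma continuous_on_boundary: "continuous_on {0<..} l"
  by (intro continuous_at_imp_continuous_on) (auto intro: isCont_boundary)

text \<open>When l(s) > 0 the boundary point is a limit of points of the same slice inside the
  patch, which gives the missing inequality.\<close>

lemma F_boundary:
  assumes s: "s > 0" and l: "l s > 0" shows "F (l s, s) = 0"
proof (rule antisym)
  show "F (l s, s) \<le> 0" by (rule F_boundary_nonpos[OF s])
  have lim: "((\<lambda>t. F (t, s)) \<longlongrightarrow> F (l s, s)) (at_left (l s))"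
    using DERIV_isCont[OF DERIV_F_fst[of s "l s"]]
    by (auto simp: isCont_def intro: tendsto_mono[OF at_le])
  have "\<forall>\<^sub>F t in at_left (l s). 0 < t \<and> t < l s"
    using l unfolding eventually_at_left_field by auto
  then have ev: "\<forall>\<^sub>F t in at_left (l s). 0 \<le> F (t, s)"
  proof eventually_elim
    case (elim t)
    then have "(t, s) \<in> \<Omega>" using s by (simp add: in_patch_iff)
    then show ?case using level_F[OF s] by (simp add: less_imp_le)
  qed
  show "0 \<le> F (l s, s)"
    by (rule tendsto_lowerbound[OF lim ev]) simp
qed

definition dl :: "real \<Rightarrow> real" where
  "dl s = - ((snd (d\<psi> (l s, s)) - W) / fst (d\<psi> (l s, s)))"

lemma DERIV_boundary:
  assumes s: "s > 0" and l: "l s > 0"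
  shows "(l has_real_derivative dl s) (at s)"
proof -
  let ?d = "d\<psi> (l s, s) - (0, W)"
  have "(F has_derivative (\<lambda>h. d\<psi> (l s, s) \<bullet> h - W * snd h)) (at (l s, s))"
    unfolding F_def by (auto intro!: derivative_eq_intros has_derivative_\<psi>)
  then have "(F has_derivative (\<lambda>h. ?d \<bullet> h)) (at (l s, s))"
    by (simp add: inner_diff_left inner_prod_def[of "(0, W)"])
  then have "(l has_real_derivative - (snd ?d / fst ?d)) (at s)"
  proof (rule has_real_derivative_implicit)
    show "fst ?d \<noteq> 0" using fst_d\<psi>_neg[OF l s] by simp
    show "isCont l s" using s by (rule isCont_boundary)
    have "\<forall>\<^sub>F t in at s. l t > 0"
      using isCont_boundary[OF s] l unfolding isCont_def by (rule order_tendstoD(1))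
    moreover have "\<forall>\<^sub>F t in at s. t > 0"
      using s by (intro order_tendstoD(1)[OF tendsto_ident_at])
    ultimately show "\<forall>\<^sub>F t in at s. F (l t, t) = F (l s, s)"
      by eventually_elim (simp add: F_boundary s l)
  qed
  then show ?thesis by (simp add: dl_def)
qed

text \<open>A bootstrap: continuity of \<open>dl\<close> on the compact interval makes l Lipschitz,
  so \<open>d\<psi>\<close> along the boundary curve is r-Hoelder, and then so is \<open>dl\<close>,
  a quotient whose denominator stays away from 0.\<close>

lemma C1_holder_boundary:
  assumes "0 < \<epsilon>" "\<epsilon> < L" and pos: "\<And>s. s \<in> {\<epsilon>..L} \<Longrightarrow> l s > 0" and r: "0 < r" "r < 1"
  shows "C1_holder r \<epsilon> L l"
proof -
  let ?I = "{\<epsilon>..L}"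
  define p where "p s = d\<psi> (l s, s)" for s
  have I: "s > 0" if "s \<in> ?I" for s using that assms by auto
  have "continuous_on ?I l"
    using I by (intro continuous_on_subset[OF continuous_on_boundary]) auto
  then have p_cont: "continuous_on ?I p"
    unfolding p_def
    by (intro continuous_on_compose2[OF continuous_on_d\<psi>[of UNIV]] continuous_intros) auto
  have neg: "fst (p s) < 0" if "s \<in> ?I" for s
    unfolding p_def using pos[OF that] I[OF that] by (rule fst_d\<psi>_neg)
  have deriv: "(l has_real_derivative dl s) (at s within ?I)" if "s \<in> ?I" for s
    using DERIV_boundary[OF I[OF that] pos[OF that]] by (rule has_field_derivative_at_within)
  have dl_cont: "continuous_on ?I dl"
    unfolding dl_def p_def[symmetric] using neg
    by (intro continuous_intros p_cont) force
  obtain K where K: "\<And>s. s \<in> ?I \<Longrightarrow> norm (dl s) \<le> K" and "K > 0"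
    using compact_imp_bounded[OF compact_continuous_image[OF dl_cont compact_Icc]]
    unfolding bounded_pos by blast
  have lip: "\<bar>l x - l y\<bar> \<le> K * \<bar>x - y\<bar>" if "x \<in> ?I" "y \<in> ?I" for x y
    using field_differentiable_bound[OF convex_real_interval(5) deriv K that(1) that(2)]
    by (simp add: abs_minus_commute)
  obtain N where N: "\<And>s. s \<in> ?I \<Longrightarrow> norm (p s) \<le> N" and "N > 0"
    using compact_imp_bounded[OF compact_continuous_image[OF p_cont compact_Icc]]
    unfolding bounded_pos by blast
  have "continuous_on ?I (\<lambda>s. \<bar>fst (p s)\<bar>)" by (intro continuous_intros p_cont)
  from continuous_attains_inf[OF compact_Icc _ this] obtain s0 where s0: "s0 \<in> ?I"
    "\<And>s. s \<in> ?I \<Longrightarrow> \<bar>fst (p s0)\<bar> \<le> \<bar>fst (p s)\<bar>" using \<open>\<epsilon> < L\<close> by auto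
  define \<mu> where "\<mu> = \<bar>fst (p s0)\<bar>"
  have "\<mu> > 0" using neg[OF s0(1)] by (simp add: \<mu>_def)
  obtain C where C: "C \<ge> 0" "\<And>x x'. norm (d\<psi> x' - d\<psi> x) \<le> C * norm (x' - x) powr r"
    by (rule d\<psi>_holder[OF r], rule that)
  \<comment> \<open>The constant of \<open>quotient_difference_le\<close>; N + |W| bounds the
    numerator of the slope.\<close>
  define c where "c = 1 / \<mu> + (N + \<bar>W\<bar>) / \<mu>\<^sup>2"
  have "c \<ge> 0" using \<open>\<mu> > 0\<close> \<open>N > 0\<close> by (simp add: c_def)
  have "\<bar>dl x - dl y\<bar> \<le> (c * C * (K + 1) powr r) * \<bar>x - y\<bar> powr r" if x: "x \<in> ?I" and y: "y \<in> ?I" for x y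
  proof -
    have "norm ((l x, x) - (l y, y)) \<le> \<bar>l x - l y\<bar> + \<bar>x - y\<bar>"
      using norm_Pair_le[of "l x - l y" "x - y"] by simp
    also have "\<dots> \<le> (K + 1) * \<bar>x - y\<bar>" using lip[OF x y] by (simp add: algebra_simps)
    finally have "norm ((l x, x) - (l y, y)) powr r \<le> ((K + 1) * \<bar>x - y\<bar>) powr r"
      using r by (intro powr_mono2) auto
    then have "norm (p x - p y) \<le> C * ((K + 1) * \<bar>x - y\<bar>) powr r" (is "_ \<le> ?\<delta>")
      using C(2)[of "(l x, x)" "(l y, y)"] mult_left_mono[OF _ C(1)] unfolding p_def
      by (meson order_trans)
    moreover have component_le: "\<bar>fst z\<bar> \<le> norm z" "\<bar>snd z\<bar> \<le> norm z" for z :: "real \<times> real"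
      using norm_fst_le[of "fst z" "snd z"] norm_snd_le[of "snd z" "fst z"] by auto
    note component_le[of "p x - p y"]
    moreover have "\<bar>snd (p y) - W\<bar> \<le> N + \<bar>W\<bar>"
      using abs_triangle_ineq4[of "snd (p y)" W] component_le(2)[of "p y"] N[OF y] by simp
    ultimately have "\<bar>(snd (p x) - W) / fst (p x) - (snd (p y) - W) / fst (p y)\<bar> \<le> c * ?\<delta>"
      unfolding c_def using s0(2)[OF x] s0(2)[OF y] N[OF y] \<open>\<mu> > 0\<close>
      by (intro quotient_difference_le) (auto simp: \<mu>_def)
    also have "c * ?\<delta> = (c * C * (K + 1) powr r) * \<bar>x - y\<bar> powr r"
      using \<open>K > 0\<close> by (simp add: powr_mult)
    finally show ?thesis by (simp add: dl_def p_def abs_minus_commute)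
  qed
  with deriv dl_cont show ?thesis unfolding C1_holder_def by blast
qed

end

section \<open>From almost everywhere representatives to patches\<close>

lemma stream_cong_AE:
  assumes "w \<in> borel_measurable lebesgue" "AE y in lebesgue. v y = w y"
  shows "stream v = stream w"
proof
  fix x :: "real \<times> real"
  let ?k = "\<lambda>y. 1 / (2 * pi) * ln (norm (x - y))"
  have k: "?k \<in> borel_measurable lebesgue" by (rule measurable_completion) simp
  have ae: "AE y in lebesgue. w y = v y" using assms(2) by (rule eventually_mono) simp
  \<comment> \<open>Completeness of Lebesgue measure passes measurability on to v.\<close>
  have v: "v \<in> borel_measurable lebesgue" using borel_measurable_AE[OF assms(1) ae] .
  have "(LINT y|lebesgue. v y *\<^sub>R ?k y) = (LINT y|lebesgue. w y *\<^sub>R ?k y)"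
  proof (rule integral_cong_AE)
    show "AE y in lebesgue. v y *\<^sub>R ?k y = w y *\<^sub>R ?k y" using assms(2) by (rule eventually_mono) simp
  qed (intro borel_measurable_scaleR assms(1) v k)+
  then show "stream v x = stream w x" by (simp only: stream_def conv_def)
qed

text \<open>Rules out the empty patch, since a boundary function comes with positive speed.\<close>

lemma speed_eq_0_if_AE_zero:
  assumes "AE y in lebesgue. w y = 0"
  shows "speed w = 0"
proof -
  have "conv biot_savart w x = 0" for x
    unfolding conv_def using assms by (intro integral_eq_zero_AE) (rule eventually_mono, auto)
  then show ?thesis by (simp add: speed_def energy_def)
qed

lemma AE_zero_if_shift:
  assumes "AE x in lebesgue. shift_x1 \<tau> w x = 0"
  shows "AE y in lebesgue. w y = 0"
proof -
  have "AE x in lborel. shift_x1 \<tau> w x = 0" using assms by (simp add: AE_completion_iff)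
  from AE_axis_isometry[OF _ _ this, of 1 1 \<tau> 0] show ?thesis
    by (simp add: shift_x1_def AE_completion)
qed

lemma boundary_function_traveling_patch:
  assumes "boundary_function w l"
  obtains \<Omega> where "traveling_patch \<Omega> l (speed w)"
proof -
  obtain \<tau> \<Omega> where \<Omega>: "open \<Omega>" "bounded \<Omega>" "\<Omega> \<subseteq> half_plane"
    and ae: "AE x in lebesgue. shift_x1 \<tau> w x = odd_patch \<Omega> x"
    and level: "\<Omega> = {x \<in> half_plane. stream (shift_x1 \<tau> w) x - speed w * snd x > 0}"
    and slice: "\<And>s. s > 0 \<Longrightarrow> {x \<in> \<Omega>. snd x = s} = {(x1, s) | x1. \<bar>x1\<bar> < l s}"
    and l: "\<And>s. s > 0 \<Longrightarrow> l s \<ge> 0" and W: "speed w > 0"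
    using assms unfolding boundary_function_def by blast
  have "\<Omega> \<noteq> {}"
  proof
    assume "\<Omega> = {}"
    then have "AE x in lebesgue. shift_x1 \<tau> w x = 0"
      using ae by (simp add: odd_patch_def reflected_def)
    then show False using speed_eq_0_if_AE_zero[OF AE_zero_if_shift] W by force
  qed
  moreover have "(a, s) \<in> \<Omega> \<longleftrightarrow> \<bar>a\<bar> < l s" if "s > 0" for a s
    using slice[OF that] by (auto simp: set_eq_iff)
  ultimately interpret steiner_patch \<Omega> l
    using \<Omega> by unfold_locales
  have [measurable]: "odd_patch \<Omega> \<in> borel_measurable borel"
    unfolding odd_patch_def indicator_def reflected_iff by measurable
  have "stream (shift_x1 \<tau> w) = stream (odd_patch \<Omega>)"
    using ae by (intro stream_cong_AE) (auto intro: measurable_completion)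
  with level have "x \<in> \<Omega> \<longleftrightarrow> speed w * snd x < \<psi> x" if "x \<in> half_plane" for x
    using that by (auto simp: stream_odd_patch)
  then have "traveling_patch \<Omega> l (speed w)"
    using l by unfold_locales
  then show thesis by (rule that)
qed

theorem theorem1p7:
  fixes w :: "real \<times> real \<Rightarrow> real" and l :: "real \<Rightarrow> real"
  assumes "w \<in> maximizers" and "boundary_function w l"
  shows "continuous_on {0<..} l \<and>
    (\<exists>c>0. (l \<longlongrightarrow> c) (at_right 0)) \<and>
    (\<exists>L>0. \<forall>\<epsilon>\<in>{0<..<L}. \<forall>r\<in>{0<..<1}. C1_holder r \<epsilon> L l)"
proof -
  obtain \<Omega> where "traveling_patch \<Omega> l (speed w)"
    using assms(2) by (rule boundary_function_traveling_patch)
  then interpret traveling_patch \<Omega> l "speed w" .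
  obtain c where "c > 0" and c: "(l \<longlongrightarrow> c) (at_right 0)"
    using boundary_limit by blast
  have "\<forall>\<^sub>F s in at_right 0. l s > 0"
    using c \<open>c > 0\<close> by (rule order_tendstoD(1))
  then obtain b where "b > 0" and b: "\<And>s. 0 < s \<Longrightarrow> s < b \<Longrightarrow> l s > 0"
    by (auto simp: eventually_at_right_field)
  \<comment> \<open>L = b/2 because positivity of l is known only on the open interval below b,
    while the closed interval up to L is needed.\<close>
  have "C1_holder r \<epsilon> (b / 2) l" if "\<epsilon> \<in> {0<..<b / 2}" "r \<in> {0<..<1}" for \<epsilon> r
    using that \<open>b > 0\<close> by (intro C1_holder_boundary b) auto
  then show ?thesis
    using continuous_on_boundary boundary_limit \<open>b > 0\<close> by (auto intro!: exI[of _ "b / 2"])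
qed

end
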